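(* Let $\theta<\lambda$ be infinite cardinals. If $J[\lambda^+]$ contains a stationary subset of $E^{\lambda^+}_\theta$, then $J[\lambda^+]$ contains every stationary subset of $E^{\lambda^+}_\theta$ that lies in $I[\lambda^+]$. In particular, if $\lambda$ is regular and $J[\lambda^+]$ contains a stationary subset of $E^{\lambda^+}_\theta$, then $E^{\lambda^+}_\theta\in J[\lambda^+]$.
   Context: For a regular uncountable cardinal $\kappa$, $E^\kappa_\theta=\{\alpha<\kappa\mid\mathrm{cf}(\alpha)=\theta\}$, and $[\kappa]^{<\chi}$ is the set of subsets of $\kappa$ of size $<\chi$. For $\chi$ either $2$ or an infinite cardinal, $J_\chi[\kappa]$ is the collection of all $S\subseteq\kappa$ for which there exist a club $C\subseteq\kappa$ and functions $f_i:\kappa\to[\kappa]^{<\chi}$ ($i<\kappa$) such that for every $\alpha\in S\cap C$, every regressive $f:\alpha\to\alpha$ and every cofinal $B\subseteq\alpha$, there is $i<\alpha$ with $\sup\{\beta\in B\mid f(\beta)\in f_i(\beta)\}=\alpha$. $J[\kappa]$ denotes $J_2[\kappa]$ (so each $f_i(\beta)$ is empty or a singleton). $I[\kappa]$ is Shelah's approachability ideal: $S\in I[\kappa]$ iff there are a sequence $\langle a_\beta\mid\beta<\kappa\rangle$ of bounded subsets of $\kappa$ and a club $C\subseteq\kappa$ such that each $\alpha\in S\cap C$ has a cofinal $A\subseteq\alpha$ of order type $\mathrm{cf}(\alpha)$ with $\{A\cap\gamma\mid\gamma<\alpha\}\subseteq\{a_\beta\mid\beta<\alpha\}$. *)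

theory Defs
  imports Main
begin

unbundle cardinal_syntax

text \<open>Ordinals below a regular cardinal kappa are represented as the elements of
  Field k for a (cardinal) well-order k; the ordinal alpha is identified with
  the set of its predecessors, underS k alpha.\<close>

definition olt :: "'a rel \<Rightarrow> 'a \<Rightarrow> 'a \<Rightarrow> bool" where
  "olt k x y \<longleftrightarrow> (x, y) \<in> k \<and> x \<noteq> y"

definition sup_is :: "'a rel \<Rightarrow> 'a set \<Rightarrow> 'a \<Rightarrow> bool" where
  "sup_is k X \<alpha> \<longleftrightarrow> X \<subseteq> underS k \<alpha> \<and> (\<forall>\<gamma>\<in>underS k \<alpha>. \<exists>\<beta>\<in>X. olt k \<gamma> \<beta>)"

definition cofinal_sub :: "'a rel \<Rightarrow> 'a set \<Rightarrow> 'a \<Rightarrow> bool" where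
  "cofinal_sub k A \<alpha> \<longleftrightarrow> A \<subseteq> underS k \<alpha> \<and> (\<forall>\<gamma>\<in>underS k \<alpha>. \<exists>\<beta>\<in>A. (\<gamma>, \<beta>) \<in> k)"

definition cf_is :: "'a rel \<Rightarrow> 'a \<Rightarrow> 'b rel \<Rightarrow> bool" where
  "cf_is k \<alpha> \<theta> \<longleftrightarrow> (\<exists>A. cofinal_sub k A \<alpha> \<and> (card_of A) =o \<theta>) \<and>
      (\<forall>B. cofinal_sub k B \<alpha> \<longrightarrow> \<theta> \<le>o (card_of B))"

definition Ecof :: "'a rel \<Rightarrow> 'b rel \<Rightarrow> 'a set" where
  "Ecof k \<theta> = {\<alpha> \<in> Field k. cf_is k \<alpha> \<theta>}"

definition club :: "'a rel \<Rightarrow> 'a set \<Rightarrow> bool" where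
  "club k C \<longleftrightarrow> C \<subseteq> Field k \<and> (\<forall>\<gamma>\<in>Field k. \<exists>\<beta>\<in>C. olt k \<gamma> \<beta>) \<and>
     (\<forall>\<alpha>\<in>Field k. underS k \<alpha> \<noteq> {} \<and> sup_is k (C \<inter> underS k \<alpha>) \<alpha> \<longrightarrow> \<alpha> \<in> C)"

definition stationary :: "'a rel \<Rightarrow> 'a set \<Rightarrow> bool" where
  "stationary k S \<longleftrightarrow> S \<subseteq> Field k \<and> (\<forall>C. club k C \<longrightarrow> S \<inter> C \<noteq> {})"

definition regressive :: "'a rel \<Rightarrow> ('a \<Rightarrow> 'a) \<Rightarrow> 'a \<Rightarrow> bool" where
  "regressive k f \<alpha> \<longleftrightarrow> (\<forall>\<beta>\<in>underS k \<alpha>. f \<beta> \<in> underS k \<alpha> \<and>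
       (underS k \<beta> \<noteq> {} \<longrightarrow> olt k (f \<beta>) \<beta>))"

text \<open>J[kappa] = J_2[kappa]: each f_i(beta) is empty or a singleton\<close>
definition Jideal :: "'a rel \<Rightarrow> 'a set set" where
  "Jideal k = {S. S \<subseteq> Field k \<and>
     (\<exists>C F. club k C \<and>
        (\<forall>i\<in>Field k. \<forall>\<beta>\<in>Field k. F i \<beta> = {} \<or> (\<exists>x\<in>Field k. F i \<beta> = {x})) \<and>
        (\<forall>\<alpha>\<in>S \<inter> C. \<forall>f B. regressive k f \<alpha> \<and> cofinal_sub k B \<alpha> \<longrightarrow>
            (\<exists>i\<in>underS k \<alpha>. sup_is k {\<beta>\<in>B. f \<beta> \<in> F i \<beta>} \<alpha>)))}"

text \<open>Shelah's approachability ideal I[kappa]. "A has order type cf(alpha)" is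
  expressed as: the order type of A is an initial ordinal (Card_order) and (card_of A)
  is the least cardinality of a cofinal subset of alpha.\<close>
definition Iideal :: "'a rel \<Rightarrow> 'a set set" where
  "Iideal k = {S. S \<subseteq> Field k \<and>
     (\<exists>a C. (\<forall>\<beta>\<in>Field k. \<exists>\<gamma>\<in>Field k. a \<beta> \<subseteq> underS k \<gamma>) \<and> club k C \<and>
        (\<forall>\<alpha>\<in>S \<inter> C. \<exists>A. cofinal_sub k A \<alpha> \<and> Card_order (Restr k A) \<and>
            (\<forall>B. cofinal_sub k B \<alpha> \<longrightarrow> (card_of A) \<le>o (card_of B)) \<and>
            (\<forall>\<gamma>\<in>underS k \<alpha>. \<exists>\<beta>\<in>underS k \<alpha>. A \<inter> underS k \<gamma> = a \<beta>)))}"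

end

(*
  Write k for lambda^+ and fix enumerations e_b of b in order type at most lambda. One point alpha_0
  of a stationary set in J[k], together with its witness F, already carries all the information that
  is needed: by diagonalising against F, every function from a cofinal subset of alpha_0 to lambda is
  bounded on a cofinal subset (so cf(lambda) differs from theta), and F guesses, up to cofinality,
  every theta-sequence of elements of lambda. Both facts depend only on theta and lambda, so they
  transfer to any other alpha of cofinality theta. What is missing is a way to recognise,
  from b alone, the position of b in a cofinal subset of alpha of type theta. For this, let cl_mu(b) be
  the closure of b under the maps e(eta), eta < mu, and under the small sets a_b of an approachability
  witness. Each cl_mu(b) has fewer than lambda elements, so a greedy colouring r_mu of k by lambda
  separates any two points one of which lies in the closure of the other. Approachability (or
  regularity of lambda) makes some r_mu have bounded fibres on a cofinal part of any cofinal B.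
  Composing r_mu with a ladder from a suitable rho < lambda to alpha_0 turns b into a
  point of alpha_0, where F can be evaluated.
*)
theory Submission
  imports Defs
begin

section \<open>Initial segments of well-orders and small cardinalities\<close>

lemma underS_trans:
  assumes "Well_order k" "x \<in> underS k y" "y \<in> underS k z"
  shows "x \<in> underS k z"
  using assms unfolding underS_def order_on_defs trans_def antisym_def by blast

lemma underS_total:
  assumes "Well_order k" "x \<in> Field k" "y \<in> Field k"
  shows "x \<in> underS k y \<or> x = y \<or> y \<in> underS k x"
  using assms unfolding underS_def order_on_defs total_on_def by blast

lemma underS_asym:
  assumes "Well_order k" "x \<in> underS k y"
  shows "y \<notin> underS k x"
  using assms unfolding underS_def order_on_defs antisym_def by blast

lemma underS_FieldD:
  assumes "x \<in> underS k y"
  shows "x \<in> Field k" "y \<in> Field k"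
  using assms unfolding underS_def Field_def by auto

lemma wf_underS:
  assumes "Well_order k"
  shows "wf {(x, y). x \<in> underS k y}"
proof -
  have "{(x, y). x \<in> underS k y} = k - Id" by (auto simp: underS_def)
  then show ?thesis using assms by (simp add: well_order_on_def)
qed

lemma olt_iff_underS: "olt k x y \<longleftrightarrow> x \<in> underS k y"
  by (auto simp: olt_def underS_def)

lemma sup_is_iff: "sup_is k X \<alpha> \<longleftrightarrow> X \<subseteq> underS k \<alpha> \<and> (\<forall>\<gamma>\<in>underS k \<alpha>. \<exists>\<beta>\<in>X. \<gamma> \<in> underS k \<beta>)"
  by (simp add: sup_is_def olt_iff_underS)

lemma card_subset_less: "A \<subseteq> B \<Longrightarrow> |B| <o r \<Longrightarrow> |A| <o r"
  by (rule ordLeq_ordLess_trans[OF card_of_mono1])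

lemma card_image_less: "|A| <o r \<Longrightarrow> |f ` A| <o r"
  by (rule ordLeq_ordLess_trans[OF card_of_image])

section \<open>Reachability and greedy colouring\<close>

text \<open>Counting by path length: induction bounds the points with a path of \<open>n\<close>
  steps to \<open>y\<close>, and a countable union of such sets has size at most the infinite
  \<open>|N|\<close>.\<close>

lemma card_rtrancl_preds:
  assumes N: "infinite N" and R: "\<And>y. |{x. (x, y) \<in> R}| \<le>o |N|"
  shows "|{x. (x, y) \<in> R\<^sup>*}| \<le>o |N|"
proof -
  have step: "|{x. (x, y) \<in> R ^^ n}| \<le>o |N|" for n
  proof (induction n)
    case 0
    have "{x. (x, y) \<in> R ^^ 0} = {y}" by auto
    moreover have "|{y}| \<le>o |N|"
      using N by (metis card_of_singl_ordLeq finite.emptyI)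
    ultimately show ?case by simp
  next
    case (Suc n)
    have "{x. (x, y) \<in> R ^^ Suc n} = (\<Union>z\<in>{z. (z, y) \<in> R ^^ n}. {x. (x, z) \<in> R})"
      by (auto intro: relpow_Suc_I2 dest: relpow_Suc_D2 simp del: relpow.simps)
    then show ?case
      by (simp only:) (rule card_of_UNION_ordLeq_infinite[OF N Suc], intro ballI, rule R)
  qed
  have "{x. (x, y) \<in> R\<^sup>*} = (\<Union>n. {x. (x, y) \<in> R ^^ n})"
    by (auto simp: rtrancl_power)
  moreover have "|UNIV :: nat set| \<le>o |N|" using N infinite_iff_card_of_nat by blast
  ultimately show ?thesis
    by (simp only:) (rule card_of_UNION_ordLeq_infinite[OF N], assumption, intro ballI, rule step)
qed

text \<open>Well-founded recursion: the predecessors of \<open>y\<close> take fewer colours than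
  \<open>r\<close> offers, so some element of \<open>Field r\<close> is still free for
  \<open>y\<close>.\<close>

lemma greedy_coloring:
  assumes "wf W" "\<And>y. |{x. (x, y) \<in> W}| <o r" "Card_order r"
  shows "\<exists>c. \<forall>y. c y \<in> Field r \<and> (\<forall>x. (x, y) \<in> W \<longrightarrow> c x \<noteq> c y)"
proof (rule dependent_wf_choice[OF assms(1)])
  fix y and c :: "'a \<Rightarrow> 'b"
  have "|c ` {x. (x, y) \<in> W}| <o r"
    by (rule card_image_less[OF assms(2)])
  then have "|c ` {x. (x, y) \<in> W}| <o |Field r|"
    by (rule ordLess_ordIso_trans[OF _ ordIso_symmetric[OF card_of_Field_ordIso[OF assms(3)]]])
  then have "\<not> Field r \<subseteq> c ` {x. (x, y) \<in> W}"
    using card_of_mono1 not_ordLeq_ordLess by blast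
  then show "\<exists>v. v \<in> Field r \<and> (\<forall>x. (x, y) \<in> W \<longrightarrow> c x \<noteq> v)" by blast
qed metis

section \<open>The successor cardinal\<close>

text \<open>The last three assumptions characterise \<open>k\<close> up to isomorphism as the
  successor of \<open>lam\<close>, without fixing its representation.\<close>

locale succ_card =
  fixes lam :: "'b rel" and th :: "'c rel" and k :: "'a rel"
  assumes lam: "Card_order lam" and inf_lam: "infinite (Field lam)"
    and th: "Card_order th" and inf_th: "infinite (Field th)"
    and th_lam: "th <o lam"
    and Card_order_k: "Card_order k" and lam_k: "lam <o k"
    and card_U: "\<And>x. x \<in> Field k \<Longrightarrow> |underS k x| \<le>o lam"
begin

abbreviation U where "U \<equiv> underS k"

lemma Well_order_lam: "Well_order lam"
  using lam by (simp add: card_order_on_def)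

lemma Well_order_k: "Well_order k"
  using Card_order_k by (simp add: card_order_on_def)

lemmas U_trans = underS_trans[OF Well_order_k]
lemmas U_total = underS_total[OF Well_order_k]
lemmas U_asym = underS_asym[OF Well_order_k]
lemmas lam_trans = underS_trans[OF Well_order_lam]
lemmas lam_total = underS_total[OF Well_order_lam]

lemma U_subset: "x \<in> U y \<Longrightarrow> U x \<subseteq> U y"
  using U_trans by blast

lemma inf_k: "infinite (Field k)"
  by (rule card_of_ordLeq_infinite[OF card_of_mono2[OF ordLess_imp_ordLeq[OF lam_k]] inf_lam])

lemma k_no_max: "x \<in> Field k \<Longrightarrow> \<exists>y. x \<in> U y"
  using infinite_Card_order_limit[OF Card_order_k inf_k] by (auto simp: underS_def)

lemma lam_no_max: "x \<in> Field lam \<Longrightarrow> \<exists>y\<in>Field lam. x \<in> underS lam y"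
  using infinite_Card_order_limit[OF lam inf_lam] by (auto simp: underS_def)

lemma lam_bound2:
  assumes "x \<in> Field lam" "y \<in> Field lam"
  shows "\<exists>z\<in>Field lam. x \<in> underS lam z \<and> y \<in> underS lam z"
  using lam_total[OF assms] lam_no_max assms lam_trans by metis

text \<open>Being shorter than \<open>k\<close>, \<open>lam\<close> is isomorphic to an initial
  segment \<open>U j\<close>. From \<open>j\<close> on every initial segment has exactly
  \<open>lam\<close> elements, which is why later arguments restrict to points above
  \<open>j\<close>.\<close>

lemma ex_card_U_eq: "\<exists>j\<in>Field k. |U j| =o lam"
proof -
  obtain j where j: "j \<in> Field k" "lam =o Restr k (U j)"
    using lam_k ordLess_iff_ordIso_Restr[OF Well_order_k Well_order_lam] by blast
  have "Field (Restr k (U j)) = U j"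
    using Well_order_k underS_FieldD(1)[of _ k j] Refl_Field_Restr2[of k "U j"]
    by (auto simp: order_on_defs)
  then have "|U j| =o Restr k (U j)"
    using card_of_Field_ordIso Card_order_ordIso[OF lam ordIso_symmetric[OF j(2)]] by metis
  then show ?thesis using j ordIso_symmetric ordIso_transitive by blast
qed

lemma club_tail:
  assumes "club k C" "j \<in> Field k"
  shows "club k {\<beta>\<in>C. j \<in> U \<beta>}"
  unfolding club_def olt_iff_underS
proof (intro conjI ballI impI)
  show "{\<beta>\<in>C. j \<in> U \<beta>} \<subseteq> Field k" using assms by (auto simp: club_def)
  have C: "\<And>\<gamma>. \<gamma> \<in> Field k \<Longrightarrow> \<exists>\<beta>\<in>C. \<gamma> \<in> U \<beta>"
    using assms by (auto simp: club_def olt_iff_underS)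
  fix \<gamma> assume g: "\<gamma> \<in> Field k"
  obtain \<beta> where b: "\<beta> \<in> C" "\<gamma> \<in> U \<beta>" using C[OF g] by blast
  obtain \<beta>' where b': "\<beta>' \<in> C" "j \<in> U \<beta>'" using C[OF assms(2)] by blast
  consider "\<beta> \<in> U \<beta>'" | "\<beta> = \<beta>'" | "\<beta>' \<in> U \<beta>"
    using U_total b b' underS_FieldD by metis
  then show "\<exists>\<beta>\<in>{\<beta>\<in>C. j \<in> U \<beta>}. \<gamma> \<in> U \<beta>"
    using b b' U_trans by cases blast+
next
  fix \<alpha> assume a: "\<alpha> \<in> Field k" "U \<alpha> \<noteq> {} \<and> sup_is k ({\<beta>\<in>C. j \<in> U \<beta>} \<inter> U \<alpha>) \<alpha>"
  then have "sup_is k (C \<inter> U \<alpha>) \<alpha>" unfolding sup_is_iff by blast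
  then have "\<alpha> \<in> C" using a assms by (auto simp: club_def)
  moreover obtain \<beta> where "\<beta> \<in> {\<beta>\<in>C. j \<in> U \<beta>} \<inter> U \<alpha>" using a unfolding sup_is_iff by blast
  ultimately show "\<alpha> \<in> {\<beta>\<in>C. j \<in> U \<beta>}" using U_trans by blast
qed

lemma club_Field: "club k (Field k)"
  using k_no_max underS_FieldD(2) by (fastforce simp: club_def olt_iff_underS)

section \<open>Cofinal subsets of a point of cofinality \<open>th\<close>\<close>

context
  fixes \<alpha> assumes \<alpha>: "\<alpha> \<in> Ecof k th"
begin

lemma E_Field: "\<alpha> \<in> Field k"
  using \<alpha> by (simp add: Ecof_def)

lemma E_cofinal_ge: "cofinal_sub k X \<alpha> \<Longrightarrow> th \<le>o |X|"
  using \<alpha> by (simp add: Ecof_def cf_is_def)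

lemma E_cofinal_infinite: "cofinal_sub k X \<alpha> \<Longrightarrow> infinite X"
  using E_cofinal_ge card_of_ordLeq_infinite inf_th
  by (metis (no_types) card_of_Field_ordIso ordIso_ordLeq_trans th)

text \<open>A largest element of \<open>U \<alpha>\<close> would form a cofinal singleton, against
  infinite cofinality.\<close>

lemma E_limit: "\<gamma> \<in> U \<alpha> \<Longrightarrow> \<exists>\<delta>\<in>U \<alpha>. \<gamma> \<in> U \<delta>"
proof (rule ccontr)
  assume g: "\<gamma> \<in> U \<alpha>" and n: "\<not> (\<exists>\<delta>\<in>U \<alpha>. \<gamma> \<in> U \<delta>)"
  have "(\<delta>, \<gamma>) \<in> k" if d: "\<delta> \<in> U \<alpha>" for \<delta>
  proof -
    have "\<delta> \<in> U \<gamma> \<or> \<delta> = \<gamma>"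
      using U_total[OF underS_FieldD(1)[OF d] underS_FieldD(1)[OF g]] d n by blast
    then show ?thesis
      using Well_order_k underS_FieldD(1)[OF g] by (auto simp: order_on_defs refl_on_def underS_def)
  qed
  then have "cofinal_sub k {\<gamma>} \<alpha>" using g by (auto simp: cofinal_sub_def)
  then show False using E_cofinal_infinite by blast
qed

lemma E_ne: "U \<alpha> \<noteq> {}"
  using E_cofinal_infinite[of "{}"] by (auto simp: cofinal_sub_def)

text \<open>Points of cofinality \<open>th\<close> are limits, so weak and strict domination agree
  there; from here on \<open>sup_is\<close> serves for both notions.\<close>

lemma E_cofinal_iff: "cofinal_sub k X \<alpha> \<longleftrightarrow> sup_is k X \<alpha>"
proof
  assume X: "cofinal_sub k X \<alpha>"
  show "sup_is k X \<alpha>" unfolding sup_is_iff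
  proof (intro conjI ballI)
    show "X \<subseteq> U \<alpha>" using X by (simp add: cofinal_sub_def)
    fix \<gamma> assume "\<gamma> \<in> U \<alpha>"
    then obtain \<delta> where "\<delta> \<in> U \<alpha>" "\<gamma> \<in> U \<delta>" using E_limit by blast
    moreover from this obtain \<beta> where "\<beta> \<in> X" "(\<delta>, \<beta>) \<in> k" using X by (auto simp: cofinal_sub_def)
    moreover from this have "\<delta> = \<beta> \<or> \<delta> \<in> U \<beta>" by (auto simp: underS_def)
    ultimately show "\<exists>\<beta>\<in>X. \<gamma> \<in> U \<beta>" using U_trans by blast
  qed
next
  assume "sup_is k X \<alpha>"
  then show "cofinal_sub k X \<alpha>" unfolding sup_is_iff cofinal_sub_def underS_def by blast
qed

lemma E_ex_cofinal: "\<exists>A. sup_is k A \<alpha> \<and> |A| =o th"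
  using \<alpha> by (auto simp: Ecof_def cf_is_def simp flip: E_cofinal_iff)

lemma E_sup_ge: "sup_is k X \<alpha> \<Longrightarrow> th \<le>o |X|"
  using E_cofinal_ge E_cofinal_iff by blast

lemma E_bounded:
  assumes "X \<subseteq> U \<alpha>" "\<not> sup_is k X \<alpha>"
  shows "\<exists>\<gamma>\<in>U \<alpha>. X \<subseteq> U \<gamma>"
proof -
  obtain \<gamma> where g: "\<gamma> \<in> U \<alpha>" "\<And>\<beta>. \<beta> \<in> X \<Longrightarrow> \<gamma> \<notin> U \<beta>" using assms by (auto simp: sup_is_iff)
  obtain \<delta> where d: "\<delta> \<in> U \<alpha>" "\<gamma> \<in> U \<delta>" using E_limit g by blast
  have "X \<subseteq> U \<delta>"
    using g d U_total[of \<gamma>] U_trans assms(1) underS_FieldD(1) by (metis subsetD subsetI)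
  then show ?thesis using d by blast
qed

lemma E_small_bounded:
  assumes "X \<subseteq> U \<alpha>" "|X| <o th"
  shows "\<exists>\<gamma>\<in>U \<alpha>. X \<subseteq> U \<gamma>"
  using E_bounded[OF assms(1)] E_sup_ge[of X] not_ordLess_ordLeq[OF assms(2)] by blast

lemma E_max:
  assumes "\<gamma> \<in> U \<alpha>" "\<delta> \<in> U \<alpha>"
  shows "\<exists>\<epsilon>\<in>U \<alpha>. \<gamma> \<in> U \<epsilon> \<and> \<delta> \<in> U \<epsilon>"
  using U_total[of \<gamma> \<delta>] E_limit U_trans assms underS_FieldD(1) by metis

lemma sup_not_bounded: "sup_is k X \<alpha> \<Longrightarrow> \<gamma> \<in> U \<alpha> \<Longrightarrow> \<not> X \<subseteq> U \<gamma>"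
  unfolding sup_is_iff using U_asym by blast

lemma sup_tail:
  assumes "sup_is k X \<alpha>" "\<gamma> \<in> U \<alpha>"
  shows "sup_is k {x\<in>X. \<gamma> \<in> U x} \<alpha>"
  unfolding sup_is_iff
proof (intro conjI ballI)
  show "{x\<in>X. \<gamma> \<in> U x} \<subseteq> U \<alpha>" using assms by (auto simp: sup_is_iff)
  fix \<delta> assume "\<delta> \<in> U \<alpha>"
  then obtain \<epsilon> where e: "\<epsilon> \<in> U \<alpha>" "\<gamma> \<in> U \<epsilon>" "\<delta> \<in> U \<epsilon>" using E_max assms by blast
  then obtain x where "x \<in> X" "\<epsilon> \<in> U x" using assms by (auto simp: sup_is_iff)
  then show "\<exists>x\<in>{x\<in>X. \<gamma> \<in> U x}. \<delta> \<in> U x" using e U_trans by blast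
qed

lemma sup_is_mono: "sup_is k X \<alpha> \<Longrightarrow> X \<subseteq> Y \<Longrightarrow> Y \<subseteq> U \<alpha> \<Longrightarrow> sup_is k Y \<alpha>"
  unfolding sup_is_iff by blast

lemma sup_between: "sup_is k X \<alpha> \<Longrightarrow> X \<subseteq> Y \<Longrightarrow> Y \<subseteq> Z \<Longrightarrow> sup_is k Z \<alpha> \<Longrightarrow> sup_is k Y \<alpha>"
  unfolding sup_is_iff by blast

lemma not_sup_Un:
  assumes "X \<subseteq> U \<alpha>" "Y \<subseteq> U \<alpha>" "\<not> sup_is k X \<alpha>" "\<not> sup_is k Y \<alpha>"
  shows "\<not> sup_is k (X \<union> Y) \<alpha>"
proof -
  obtain \<gamma> \<delta> where g: "\<gamma> \<in> U \<alpha>" "X \<subseteq> U \<gamma>" "\<delta> \<in> U \<alpha>" "Y \<subseteq> U \<delta>"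
    using E_bounded assms by meson
  obtain \<epsilon> where e: "\<epsilon> \<in> U \<alpha>" "\<gamma> \<in> U \<epsilon>" "\<delta> \<in> U \<epsilon>" using E_max g by blast
  then have "X \<union> Y \<subseteq> U \<epsilon>" using g U_subset by blast
  then show ?thesis using sup_not_bounded e by blast
qed

end

section \<open>Enumerations, closures and colourings\<close>

lemma ex_enumeration:
  assumes "j \<in> Field k" "|U j| =o lam"
  shows "\<exists>e. \<forall>\<beta>. (U \<beta> \<noteq> {} \<longrightarrow> e \<beta> ` Field lam = U \<beta>) \<and> (j \<in> U \<beta> \<longrightarrow> inj_on (e \<beta>) (Field lam))"
proof (rule choice, rule allI)
  fix \<beta>
  have F: "|Field lam| =o lam" using card_of_Field_ordIso lam by blast
  show "\<exists>f. (U \<beta> \<noteq> {} \<longrightarrow> f ` Field lam = U \<beta>) \<and> (j \<in> U \<beta> \<longrightarrow> inj_on f (Field lam))"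
  proof (cases "j \<in> U \<beta>")
    case True
    then have "|U j| \<le>o |U \<beta>|" using card_of_mono1[OF U_subset] by blast
    then have "lam \<le>o |U \<beta>|" by (rule ordIso_ordLeq_trans[OF ordIso_symmetric[OF assms(2)]])
    moreover have "|U \<beta>| \<le>o lam" by (rule card_U[OF underS_FieldD(2)[OF True]])
    ultimately have "lam =o |U \<beta>|" by (simp add: ordIso_iff_ordLeq)
    then have "|Field lam| =o |U \<beta>|" by (rule ordIso_transitive[OF F])
    then obtain f where "bij_betw f (Field lam) (U \<beta>)" using card_of_ordIso by blast
    then show ?thesis by (auto simp: bij_betw_def)
  next
    case False
    show ?thesis
    proof (cases "U \<beta> = {}")
      case ne: False
      then have "\<beta> \<in> Field k" using underS_FieldD by fastforce
      then have "|U \<beta>| \<le>o |Field lam|"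
        by (rule ordLeq_ordIso_trans[OF card_U ordIso_symmetric[OF F]])
      then have "\<exists>f. f ` Field lam = U \<beta>" using ne by (rule card_of_ordLeq2[THEN iffD2, rotated])
      then show ?thesis using False by blast
    qed (use False in auto)
  qed
qed

text \<open>With \<open>a = (\<lambda>_. {})\<close> this closes only under the enumerations, which suffices for regular \<open>lam\<close>.\<close>

definition closure_step :: "('a \<Rightarrow> 'b \<Rightarrow> 'a) \<Rightarrow> ('a \<Rightarrow> 'a set) \<Rightarrow> 'b \<Rightarrow> 'a rel" where
  "closure_step e a \<mu> = {(x, y). x \<in> e y ` underS lam \<mu> \<or> x \<in> a y \<and> |a y| <o th}"

text \<open>The starred relation says that \<open>x\<close> lies in the closure of \<open>y\<close>
  at level \<open>\<mu>\<close>, the cl_mu(y) of the overview.\<close>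

definition colors :: "('a \<Rightarrow> 'b \<Rightarrow> 'a) \<Rightarrow> ('a \<Rightarrow> 'a set) \<Rightarrow> ('b \<Rightarrow> 'a \<Rightarrow> 'b) \<Rightarrow> bool" where
  "colors e a r \<longleftrightarrow> (\<forall>\<mu>\<in>Field lam. \<forall>y. r \<mu> y \<in> Field lam \<and>
     (\<forall>x\<in>U y. (x, y) \<in> (closure_step e a \<mu>)\<^sup>* \<longrightarrow> r \<mu> x \<noteq> r \<mu> y))"

text \<open>One step yields at most \<open>|underS lam \<mu>|\<close> points through
  \<open>e\<close> and fewer than \<open>th\<close> through \<open>a\<close>. The sum
  \<open>?N\<close> bounds both and is below \<open>lam\<close>; the summand \<open>Field th\<close>
  makes it infinite even when \<open>underS lam \<mu>\<close> is finite, so iterating the step does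
  not exceed it.\<close>

lemma card_closure:
  assumes "\<mu> \<in> Field lam"
  shows "|{x. (x, y) \<in> (closure_step e a \<mu>)\<^sup>*}| <o lam"
proof -
  let ?N = "underS lam \<mu> <+> Field th"
  have Ft: "|Field th| =o th" using card_of_Field_ordIso th by blast
  have inf: "infinite ?N" using inf_th by (simp add: finite_Plus_iff)
  have N1: "|underS lam \<mu>| \<le>o |?N|" by (rule card_of_Plus1)
  have N2: "th \<le>o |?N|" by (rule ordIso_ordLeq_trans[OF ordIso_symmetric[OF Ft] card_of_Plus2])
  have "|?N| <o lam"
    by (rule card_of_Plus_ordLess_infinite_Field[OF inf_lam lam card_of_underS[OF lam assms]
          ordIso_ordLess_trans[OF Ft th_lam]])
  moreover have "|{x. (x, y) \<in> closure_step e a \<mu>}| \<le>o |?N|" for y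
  proof -
    let ?A = "{x\<in>a y. |a y| <o th}"
    have "{x. (x, y) \<in> closure_step e a \<mu>} = e y ` underS lam \<mu> \<union> ?A"
      by (auto simp: closure_step_def)
    moreover have "|e y ` underS lam \<mu>| \<le>o |?N|"
      by (rule ordLeq_transitive[OF card_of_image N1])
    moreover have "|?A| \<le>o |?N|"
    proof (cases "|a y| <o th")
      case True
      then have "|a y| \<le>o |?N|" by (rule ordLeq_transitive[OF ordLess_imp_ordLeq N2])
      then show ?thesis using True by simp
    qed (simp add: card_of_empty)
    ultimately show ?thesis
      using card_of_Un_ordLeq_infinite_Field[of "|?N|"] inf card_of_Card_order Field_card_of by metis
  qed
  ultimately show ?thesis
    using ordLeq_ordLess_trans[OF card_rtrancl_preds[OF inf, of "closure_step e a \<mu>"]] by metis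
qed

text \<open>Intersecting the closure relation with the order makes it well-founded, and by
  \<open>card_closure\<close> a free colour is left at each point.\<close>

lemma ex_colors: "\<exists>r. colors e a r"
  unfolding colors_def
proof (rule bchoice[where S = "Field lam" and Q = "\<lambda>\<mu> c. \<forall>y. c y \<in> Field lam \<and>
     (\<forall>x\<in>U y. (x, y) \<in> (closure_step e a \<mu>)\<^sup>* \<longrightarrow> c x \<noteq> c y)"], rule ballI)
  fix \<mu> assume m: "\<mu> \<in> Field lam"
  let ?W = "{(x, y). x \<in> U y} \<inter> (closure_step e a \<mu>)\<^sup>*"
  have "wf ?W" using wf_underS[OF Well_order_k] wf_Int1 by blast
  moreover have "|{x. (x, y) \<in> ?W}| <o lam" for y
    by (rule card_subset_less[OF _ card_closure[OF m]]) auto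
  ultimately show "\<exists>c. \<forall>y. c y \<in> Field lam \<and>
     (\<forall>x\<in>U y. (x, y) \<in> (closure_step e a \<mu>)\<^sup>* \<longrightarrow> c x \<noteq> c y)"
    using greedy_coloring[OF _ _ lam, of ?W] by auto
qed

lemma closure_step_mono:
  assumes "\<mu> \<in> underS lam \<nu>"
  shows "(closure_step e a \<mu>)\<^sup>* \<subseteq> (closure_step e a \<nu>)\<^sup>*"
  by (rule rtrancl_mono) (use assms lam_trans in \<open>auto simp: closure_step_def\<close>)

section \<open>Transfer between points of cofinality \<open>th\<close>\<close>

text \<open>Convergence of \<open>t g\<close> to \<open>\<beta>\<close> as \<open>g\<close> runs
  through \<open>G\<close> towards \<open>\<alpha>\<close>. Such a \<open>t\<close> may be neither
  monotone nor injective, hence the sections \<open>u\<close> used below.\<close>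

definition tends :: "'a set \<Rightarrow> 'a \<Rightarrow> ('a \<Rightarrow> 'a) \<Rightarrow> 'a \<Rightarrow> bool" where
  "tends G \<alpha> t \<beta> \<longleftrightarrow> t ` G \<subseteq> U \<beta> \<and>
     (\<forall>\<nu>\<in>U \<beta>. \<exists>\<gamma>\<in>U \<alpha>. \<forall>g\<in>G. \<gamma> \<in> U g \<longrightarrow> \<nu> \<in> U (t g))"

lemma tendsD:
  "tends G \<alpha> t \<beta> \<Longrightarrow> \<nu> \<in> U \<beta> \<Longrightarrow> \<exists>\<gamma>\<in>U \<alpha>. \<forall>g\<in>G. \<gamma> \<in> U g \<longrightarrow> \<nu> \<in> U (t g)"
  by (simp add: tends_def)

text \<open>Enumerate a cofinal subset \<open>A\<close> of \<open>\<beta>\<close> along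
  \<open>G\<close> by \<open>p\<close>, and let \<open>t g\<close> dominate all \<open>p h\<close>
  with \<open>h\<close> at most \<open>g\<close>: these are fewer than \<open>th\<close> values,
  hence bounded below \<open>\<beta>\<close>.\<close>

lemma ex_tends:
  assumes "\<alpha> \<in> Ecof k th" "\<beta> \<in> Ecof k th" and G: "sup_is k G \<alpha>"
    and small: "\<And>\<gamma>. \<gamma> \<in> U \<alpha> \<Longrightarrow> |G \<inter> U \<gamma>| <o th"
  shows "\<exists>t. tends G \<alpha> t \<beta>"
proof -
  obtain A where A: "sup_is k A \<beta>" "|A| =o th" using E_ex_cofinal assms by blast
  have "A \<noteq> {}" using A(1) E_ne[OF assms(2)] by (auto simp: sup_is_iff)
  moreover have "|A| \<le>o |G|"
    by (rule ordIso_ordLeq_trans[OF A(2) E_sup_ge[OF assms(1) G]])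
  ultimately have "\<exists>p. p ` G = A" by (rule card_of_ordLeq2[THEN iffD2])
  then obtain p where p: "p ` G = A" by blast
  have "\<exists>t. t \<in> U \<beta> \<and> p ` {h\<in>G. h = g \<or> h \<in> U g} \<subseteq> U t" if g: "g \<in> G" for g
  proof -
    have ga: "g \<in> U \<alpha>" using g G by (auto simp: sup_is_iff)
    then obtain \<gamma> where \<gamma>: "\<gamma> \<in> U \<alpha>" "g \<in> U \<gamma>" using E_limit assms(1) by blast
    then have "{h\<in>G. h = g \<or> h \<in> U g} \<subseteq> G \<inter> U \<gamma>" using U_trans by blast
    then have "|{h\<in>G. h = g \<or> h \<in> U g}| <o th"
      by (rule card_subset_less[OF _ small[OF \<gamma>(1)]])
    then have "|p ` {h\<in>G. h = g \<or> h \<in> U g}| <o th"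
      by (rule card_image_less)
    moreover have "p ` {h\<in>G. h = g \<or> h \<in> U g} \<subseteq> U \<beta>" using p A(1) by (auto simp: sup_is_iff)
    ultimately show ?thesis using E_small_bounded[OF assms(2)] by blast
  qed
  then obtain t where t: "\<And>g. g \<in> G \<Longrightarrow> t g \<in> U \<beta> \<and> p ` {h\<in>G. h = g \<or> h \<in> U g} \<subseteq> U (t g)"
    by metis
  have "\<exists>\<gamma>\<in>U \<alpha>. \<forall>g\<in>G. \<gamma> \<in> U g \<longrightarrow> \<nu> \<in> U (t g)" if n: "\<nu> \<in> U \<beta>" for \<nu>
  proof -
    obtain \<gamma> where \<gamma>: "\<gamma> \<in> G" "\<nu> \<in> U (p \<gamma>)" using A(1) n p by (auto simp: sup_is_iff)
    have "\<nu> \<in> U (t g)" if "g \<in> G" "\<gamma> \<in> U g" for g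
      using t[OF that(1)] that \<gamma> U_trans by blast
    then show ?thesis using \<gamma>(1) G by (auto simp: sup_is_iff)
  qed
  then show ?thesis using t unfolding tends_def by blast
qed

lemma tends_sup_image:
  assumes t: "tends G \<alpha> t \<beta>" and G: "sup_is k G \<alpha>"
  shows "sup_is k (t ` G) \<beta>"
  unfolding sup_is_iff
proof (intro conjI ballI)
  show "t ` G \<subseteq> U \<beta>" using t by (simp add: tends_def)
  fix \<nu> assume "\<nu> \<in> U \<beta>"
  from tendsD[OF t this] obtain \<gamma> where \<gamma>: "\<gamma> \<in> U \<alpha>" "\<forall>g\<in>G. \<gamma> \<in> U g \<longrightarrow> \<nu> \<in> U (t g)"
    by blast
  then obtain g where "g \<in> G" "\<gamma> \<in> U g" using G by (auto simp: sup_is_iff)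
  then show "\<exists>\<beta>\<in>t ` G. \<nu> \<in> U \<beta>" using \<gamma> by blast
qed

text \<open>A bounded image would lie in some \<open>G \<inter> U \<gamma>\<close> with fewer than
  \<open>th\<close> points. As \<open>t\<close> undoes \<open>u\<close> on \<open>K\<close>, the
  cofinal set \<open>K\<close> would then have fewer than \<open>th\<close> points too.\<close>

lemma tends_sup_section:
  assumes "\<alpha> \<in> Ecof k th" "\<beta> \<in> Ecof k th" and G: "sup_is k G \<alpha>"
    and small: "\<And>\<gamma>. \<gamma> \<in> U \<alpha> \<Longrightarrow> |G \<inter> U \<gamma>| <o th"
    and u: "\<And>\<xi>. \<xi> \<in> K \<Longrightarrow> u \<xi> \<in> G \<and> t (u \<xi>) = \<xi>" and K: "sup_is k K \<beta>"
  shows "sup_is k (u ` K) \<alpha>"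
proof (rule ccontr)
  assume "\<not> ?thesis"
  moreover have uG: "u ` K \<subseteq> G" using u by blast
  ultimately obtain \<gamma> where \<gamma>: "\<gamma> \<in> U \<alpha>" "u ` K \<subseteq> U \<gamma>"
    using E_bounded[OF assms(1), of "u ` K"] G by (auto simp: sup_is_iff)
  have "K = t ` u ` K" using u by force
  then have "|K| \<le>o |u ` K|" by (metis card_of_image)
  also have "|u ` K| \<le>o |G \<inter> U \<gamma>|" by (rule card_of_mono1) (use uG \<gamma> in blast)
  finally have "|K| <o th" by (rule ordLeq_ordLess_trans[OF _ small[OF \<gamma>(1)]])
  then show False using E_sup_ge[OF assms(2) K] not_ordLess_ordLeq by blast
qed

end

section \<open>A single point with guessing functions\<close>

text \<open>\<open>F_guess\<close> is the guessing property of a \<open>Jideal\<close> witness at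
  the single point \<open>\<alpha>\<^sub>0\<close>; all guesses elsewhere are derived from
  it.\<close>

locale J_point = succ_card lam th k
  for lam :: "'b rel" and th :: "'c rel" and k :: "'a rel" +
  fixes j :: 'a and e :: "'a \<Rightarrow> 'b \<Rightarrow> 'a" and \<alpha>\<^sub>0 :: 'a and F :: "'a \<Rightarrow> 'a \<Rightarrow> 'a set"
  assumes j: "j \<in> Field k" "|U j| =o lam"
    and e_surj: "\<And>\<beta>. U \<beta> \<noteq> {} \<Longrightarrow> e \<beta> ` Field lam = U \<beta>"
    and e_inj: "\<And>\<beta>. j \<in> U \<beta> \<Longrightarrow> inj_on (e \<beta>) (Field lam)"
    and \<alpha>\<^sub>0: "\<alpha>\<^sub>0 \<in> Ecof k th" "j \<in> U \<alpha>\<^sub>0"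
    and F_sub: "\<And>i \<beta> x y. i \<in> Field k \<Longrightarrow> \<beta> \<in> Field k \<Longrightarrow> x \<in> F i \<beta> \<Longrightarrow> y \<in> F i \<beta> \<Longrightarrow> x = y"
    and F_guess: "\<And>f B. regressive k f \<alpha>\<^sub>0 \<Longrightarrow> sup_is k B \<alpha>\<^sub>0 \<Longrightarrow>
      \<exists>i\<in>U \<alpha>\<^sub>0. sup_is k {\<beta>\<in>B. f \<beta> \<in> F i \<beta>} \<alpha>\<^sub>0"
begin

lemma e_in: "U \<beta> \<noteq> {} \<Longrightarrow> x \<in> Field lam \<Longrightarrow> e \<beta> x \<in> U \<beta>"
  using e_surj[of \<beta>] by blast

lemma e_ex: "z \<in> U \<beta> \<Longrightarrow> \<exists>x\<in>Field lam. e \<beta> x = z"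
  using e_surj[of \<beta>] by (metis empty_iff imageE)

text \<open>Otherwise a regressive function avoiding, at each \<open>\<xi> \<in> B\<close>, the fewer than \<open>lam\<close> values
  guessed by the indices enumerated before \<open>m \<xi>\<close> would not be guessed by any index.\<close>

lemma bounded_at_point:
  assumes B: "sup_is k B \<alpha>\<^sub>0" and m: "\<And>\<xi>. \<xi> \<in> B \<Longrightarrow> m \<xi> \<in> Field lam"
  shows "\<exists>x\<in>Field lam. sup_is k {\<xi>\<in>B. m \<xi> \<in> underS lam x} \<alpha>\<^sub>0"
proof -
  have "\<exists>y. y \<in> U \<alpha>\<^sub>0 \<and> (U \<xi> \<noteq> {} \<longrightarrow> y \<in> U \<xi>) \<and>
      (\<xi> \<in> B \<and> j \<in> U \<xi> \<longrightarrow> (\<forall>i\<in>e \<alpha>\<^sub>0 ` underS lam (m \<xi>). y \<notin> F i \<xi>))"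
    if x: "\<xi> \<in> U \<alpha>\<^sub>0" for \<xi>
  proof (cases "\<xi> \<in> B \<and> j \<in> U \<xi>")
    case True
    define V where "V = (\<Union>i\<in>e \<alpha>\<^sub>0 ` underS lam (m \<xi>). F i \<xi>)"
    have "V \<subseteq> (\<lambda>i. THE y. y \<in> F i \<xi>) ` e \<alpha>\<^sub>0 ` underS lam (m \<xi>)"
    proof
      fix y assume "y \<in> V"
      then obtain \<eta> where y: "\<eta> \<in> underS lam (m \<xi>)" "y \<in> F (e \<alpha>\<^sub>0 \<eta>) \<xi>" by (auto simp: V_def)
      from this(1) have "\<eta> \<in> Field lam" by (rule underS_FieldD(1))
      then have "e \<alpha>\<^sub>0 \<eta> \<in> U \<alpha>\<^sub>0" by (rule e_in[OF E_ne[OF \<alpha>\<^sub>0(1)]])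
      then have "(THE z. z \<in> F (e \<alpha>\<^sub>0 \<eta>) \<xi>) = y"
        using y(2) by (intro the_equality F_sub[of "e \<alpha>\<^sub>0 \<eta>" \<xi>])
          (auto intro: underS_FieldD(1)[OF x] dest: underS_FieldD(1))
      then show "y \<in> (\<lambda>i. THE y. y \<in> F i \<xi>) ` e \<alpha>\<^sub>0 ` underS lam (m \<xi>)" using y(1) by blast
    qed
    then have "V \<subseteq> ((\<lambda>i. THE y. y \<in> F i \<xi>) \<circ> e \<alpha>\<^sub>0) ` underS lam (m \<xi>)" by (simp add: image_comp)
    then have "|V| \<le>o |underS lam (m \<xi>)|"
      by (rule ordLeq_transitive[OF card_of_mono1 card_of_image])
    moreover have "|underS lam (m \<xi>)| <o lam" using card_of_underS[OF lam] m True by blast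
    moreover have "lam \<le>o |U \<xi>|"
      using True by (intro ordIso_ordLeq_trans[OF ordIso_symmetric[OF j(2)] card_of_mono1[OF U_subset]]) blast
    ultimately have "|V| <o |U \<xi>|"
      by (rule ordLeq_ordLess_trans[OF _ ordLess_ordLeq_trans])
    then have "\<not> U \<xi> \<subseteq> V" using card_of_mono1 not_ordLeq_ordLess by blast
    then obtain y where y: "y \<in> U \<xi>" "y \<notin> V" by blast
    then show ?thesis using U_trans[OF y(1) x] unfolding V_def by blast
  next
    case False
    then show ?thesis using E_ne[OF \<alpha>\<^sub>0(1)] x U_trans by (metis ex_in_conv)
  qed
  then obtain f where f: "\<And>\<xi>. \<xi> \<in> U \<alpha>\<^sub>0 \<Longrightarrow> f \<xi> \<in> U \<alpha>\<^sub>0 \<and> (U \<xi> \<noteq> {} \<longrightarrow> f \<xi> \<in> U \<xi>) \<and>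
      (\<xi> \<in> B \<and> j \<in> U \<xi> \<longrightarrow> (\<forall>i\<in>e \<alpha>\<^sub>0 ` underS lam (m \<xi>). f \<xi> \<notin> F i \<xi>))"
    by metis
  then have "regressive k f \<alpha>\<^sub>0" by (auto simp: regressive_def olt_iff_underS)
  then obtain i where i: "i \<in> U \<alpha>\<^sub>0" "sup_is k {\<beta>\<in>B. f \<beta> \<in> F i \<beta>} \<alpha>\<^sub>0"
    using F_guess B by blast
  then obtain \<eta> where \<eta>: "\<eta> \<in> Field lam" "i = e \<alpha>\<^sub>0 \<eta>" using e_ex by metis
  obtain x where x: "x \<in> Field lam" "\<eta> \<in> underS lam x" using lam_no_max \<eta> by blast
  \<comment> \<open>Where \<open>i\<close> guesses \<open>f\<close> above \<open>j\<close>, the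
    position \<open>\<eta>\<close> of \<open>i\<close> was not among those avoided, so
    \<open>m \<beta>\<close> is at most \<open>\<eta>\<close>.\<close>
  have "{\<beta>\<in>{\<beta>\<in>B. f \<beta> \<in> F i \<beta>}. j \<in> U \<beta>} \<subseteq> {\<xi>\<in>B. m \<xi> \<in> underS lam x}"
  proof clarsimp
    fix \<beta> assume b: "\<beta> \<in> B" "f \<beta> \<in> F i \<beta>" "j \<in> U \<beta>"
    then have "\<beta> \<in> U \<alpha>\<^sub>0" using B by (auto simp: sup_is_iff)
    then have "\<eta> \<notin> underS lam (m \<beta>)" using b f \<eta> by blast
    then have "m \<beta> = \<eta> \<or> m \<beta> \<in> underS lam \<eta>" using lam_total[OF \<eta>(1) m[OF b(1)]] by blast
    then show "m \<beta> \<in> underS lam x" using x lam_trans by blast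
  qed
  then have "sup_is k {\<xi>\<in>B. m \<xi> \<in> underS lam x} \<alpha>\<^sub>0"
    by (rule sup_between[OF \<alpha>\<^sub>0(1) sup_tail[OF \<alpha>\<^sub>0(1) i(2) \<alpha>\<^sub>0(2)] _ _ B]) auto
  then show ?thesis using x by blast
qed

text \<open>Move \<open>G\<close> to a cofinal subset of \<open>\<alpha>\<^sub>0\<close> by
  \<open>t\<close>, apply \<open>bounded_at_point\<close> to \<open>m\<close> composed with a
  section \<open>u\<close> of \<open>t\<close>, and carry the resulting cofinal set back to
  \<open>\<alpha>\<close> by \<open>u\<close>.\<close>

lemma bounded_on_cofinal:
  assumes \<alpha>: "\<alpha> \<in> Ecof k th" and G: "sup_is k G \<alpha>"
    and small: "\<And>\<gamma>. \<gamma> \<in> U \<alpha> \<Longrightarrow> |G \<inter> U \<gamma>| <o th"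
    and m: "\<And>g. g \<in> G \<Longrightarrow> m g \<in> Field lam"
  shows "\<exists>x\<in>Field lam. sup_is k {g\<in>G. m g \<in> underS lam x} \<alpha>"
proof -
  obtain t where t: "tends G \<alpha> t \<alpha>\<^sub>0" using ex_tends[OF \<alpha> \<alpha>\<^sub>0(1) G small] by blast
  define u where "u = inv_into G t"
  have u: "u \<xi> \<in> G \<and> t (u \<xi>) = \<xi>" if "\<xi> \<in> t ` G" for \<xi>
    using that by (simp add: u_def inv_into_into f_inv_into_f)
  obtain x where x: "x \<in> Field lam" "sup_is k {\<xi>\<in>t ` G. m (u \<xi>) \<in> underS lam x} \<alpha>\<^sub>0"
    using bounded_at_point[OF tends_sup_image[OF t G], of "m \<circ> u"] u m by auto
  have "sup_is k (u ` {\<xi>\<in>t ` G. m (u \<xi>) \<in> underS lam x}) \<alpha>"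
    by (rule tends_sup_section[where t = t, OF \<alpha> \<alpha>\<^sub>0(1) G small _ x(2)]) (use u in auto)
  moreover have "u ` {\<xi>\<in>t ` G. m (u \<xi>) \<in> underS lam x} \<subseteq> {g\<in>G. m g \<in> underS lam x}"
    using u by auto
  ultimately have "sup_is k {g\<in>G. m g \<in> underS lam x} \<alpha>"
    by (rule sup_between[OF \<alpha> _ _ _ G]) auto
  then show ?thesis using x(1) by blast
qed

section \<open>Ladders to \<open>\<alpha>\<^sub>0\<close>\<close>

text \<open>A sequence of length \<open>\<rho>\<close> converging to
  \<open>\<alpha>\<^sub>0\<close>. Only \<open>\<rho>\<close> and \<open>\<alpha>\<^sub>0\<close>
  enter, so one choice per \<open>\<rho>\<close> can serve all points of cofinality
  \<open>th\<close>.\<close>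

definition ladder :: "'b \<Rightarrow> ('b \<Rightarrow> 'a) \<Rightarrow> bool" where
  "ladder \<rho> c \<longleftrightarrow> c ` underS lam \<rho> \<subseteq> U \<alpha>\<^sub>0 \<and>
     (\<forall>\<nu>\<in>U \<alpha>\<^sub>0. \<exists>x\<in>underS lam \<rho>. \<forall>y\<in>underS lam \<rho>. (x, y) \<in> lam \<longrightarrow> \<nu> \<in> U (c y))"

text \<open>Take the least \<open>\<rho>\<close> below which \<open>r\<close> sends a cofinal part
  of \<open>G\<close>. Minimality and bounded fibres make \<open>r g\<close> converge to
  \<open>\<rho>\<close> along this part, so any ladder of length \<open>\<rho>\<close> composed with
  \<open>r\<close> converges to \<open>\<alpha>\<^sub>0\<close>. Quantifying over all
  \<open>c\<close> admits a ladder chosen without reference to \<open>\<alpha>\<close>.\<close>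

lemma ex_ladder:
  assumes \<alpha>: "\<alpha> \<in> Ecof k th" and G: "sup_is k G \<alpha>"
    and small: "\<And>\<gamma>. \<gamma> \<in> U \<alpha> \<Longrightarrow> |G \<inter> U \<gamma>| <o th"
    and r: "\<And>g. g \<in> G \<Longrightarrow> r g \<in> Field lam"
    and fib: "\<And>v. \<not> sup_is k {g\<in>G. r g = v} \<alpha>"
  shows "\<exists>\<rho>\<in>Field lam. sup_is k {g\<in>G. r g \<in> underS lam \<rho>} \<alpha> \<and> (\<exists>c. ladder \<rho> c) \<and>
    (\<forall>c. ladder \<rho> c \<longrightarrow> tends {g\<in>G. r g \<in> underS lam \<rho>} \<alpha> (c \<circ> r) \<alpha>\<^sub>0)"
proof -
  have GU: "{g\<in>G. P g} \<subseteq> U \<alpha>" for P using G by (auto simp: sup_is_iff)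
  define Q where "Q = {x\<in>Field lam. sup_is k {g\<in>G. r g \<in> underS lam x} \<alpha>}"
  have "Q \<noteq> {}" using bounded_on_cofinal[OF \<alpha> G small, of r] r by (auto simp: Q_def)
  then obtain \<rho> where rho: "\<rho> \<in> Q" and min: "\<And>x. x \<in> underS lam \<rho> \<Longrightarrow> x \<notin> Q"
    using wf_underS[OF Well_order_lam] by (metis (mono_tags, lifting) case_prodI ex_in_conv mem_Collect_eq wfE_min)
  let ?G' = "{g\<in>G. r g \<in> underS lam \<rho>}"
  have G': "sup_is k ?G' \<alpha>" using rho by (simp add: Q_def)
  \<comment> \<open>A union of two bounded sets: colours strictly below \<open>x\<close>, by
    minimality of \<open>\<rho>\<close>, and the colour \<open>x\<close> itself, by
    \<open>fib\<close>.\<close>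
  have bdd: "\<exists>\<gamma>\<in>U \<alpha>. {g\<in>G. (r g, x) \<in> lam} \<subseteq> U \<gamma>" if x: "x \<in> underS lam \<rho>" for x
  proof (rule E_bounded[OF \<alpha> GU])
    have "\<not> sup_is k {g\<in>G. r g \<in> underS lam x} \<alpha>"
      using min[OF x] underS_FieldD(1)[OF x] by (auto simp: Q_def)
    from not_sup_Un[OF \<alpha> GU GU this fib[of x]]
    have "\<not> sup_is k ({g\<in>G. r g \<in> underS lam x} \<union> {g\<in>G. r g = x}) \<alpha>" .
    moreover have "{g\<in>G. (r g, x) \<in> lam} \<subseteq> {g\<in>G. r g \<in> underS lam x} \<union> {g\<in>G. r g = x}"
      by (auto simp: underS_def)
    ultimately show "\<not> sup_is k {g\<in>G. (r g, x) \<in> lam} \<alpha>"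
      using sup_is_mono[OF \<alpha>, of "{g\<in>G. (r g, x) \<in> lam}"] Un_least[OF GU GU] by meson
  qed
  have "\<exists>c. ladder \<rho> c"
  proof -
    obtain t where t: "tends G \<alpha> t \<alpha>\<^sub>0" using ex_tends[OF \<alpha> \<alpha>\<^sub>0(1) G small] by blast
    \<comment> \<open>The ladder sends \<open>x\<close> to a point \<open>h x\<close> of
      \<open>G\<close> beyond all points of colour at most \<open>x\<close>, and then by
      \<open>t\<close> into \<open>\<alpha>\<^sub>0\<close>.\<close>
    have "\<exists>g\<in>G. {g\<in>G. (r g, x) \<in> lam} \<subseteq> U g" if x: "x \<in> underS lam \<rho>" for x
    proof -
      from bdd[OF x] obtain \<gamma> where "\<gamma> \<in> U \<alpha>" "{g\<in>G. (r g, x) \<in> lam} \<subseteq> U \<gamma>" ..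
      moreover from this obtain g where "g \<in> G" "\<gamma> \<in> U g" using G by (auto simp: sup_is_iff)
      ultimately show ?thesis using U_subset by blast
    qed
    then obtain h where h: "\<And>x. x \<in> underS lam \<rho> \<Longrightarrow> h x \<in> G \<and> {g\<in>G. (r g, x) \<in> lam} \<subseteq> U (h x)"
      by metis
    have "ladder \<rho> (t \<circ> h)" unfolding ladder_def
    proof (intro conjI ballI)
      show "(t \<circ> h) ` underS lam \<rho> \<subseteq> U \<alpha>\<^sub>0" using h t by (auto simp: tends_def)
      fix \<nu> assume "\<nu> \<in> U \<alpha>\<^sub>0"
      from tendsD[OF t this] obtain \<gamma> where \<gamma>: "\<gamma> \<in> U \<alpha>" "\<forall>g\<in>G. \<gamma> \<in> U g \<longrightarrow> \<nu> \<in> U (t g)"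
        by blast
      \<comment> \<open>The threshold is the colour of some \<open>b\<close> beyond
        \<open>\<gamma>\<close>: for \<open>y\<close> from \<open>r b\<close> on, \<open>h y\<close>
        lies beyond \<open>b\<close>.\<close>
      then obtain b where b: "b \<in> ?G'" "\<gamma> \<in> U b" using G' unfolding sup_is_iff by blast
      have "\<nu> \<in> U ((t \<circ> h) y)" if "y \<in> underS lam \<rho>" "(r b, y) \<in> lam" for y
      proof -
        have "b \<in> U (h y)" using h[OF that(1)] that(2) b by blast
        then have "\<gamma> \<in> U (h y)" by (rule U_trans[OF b(2)])
        then show ?thesis using \<gamma> h that by auto
      qed
      then show "\<exists>x\<in>underS lam \<rho>. \<forall>y\<in>underS lam \<rho>. (x, y) \<in> lam \<longrightarrow> \<nu> \<in> U ((t \<circ> h) y)"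
        using b by blast
    qed
    then show ?thesis by blast
  qed
  moreover have "tends ?G' \<alpha> (c \<circ> r) \<alpha>\<^sub>0" if c: "ladder \<rho> c" for c
    unfolding tends_def
  proof (intro conjI ballI)
    show "(c \<circ> r) ` ?G' \<subseteq> U \<alpha>\<^sub>0" using c by (auto simp: ladder_def)
    fix \<nu> assume "\<nu> \<in> U \<alpha>\<^sub>0"
    then have "\<exists>x\<in>underS lam \<rho>. \<forall>y\<in>underS lam \<rho>. (x, y) \<in> lam \<longrightarrow> \<nu> \<in> U (c y)"
      using c by (simp add: ladder_def)
    then obtain x where x: "x \<in> underS lam \<rho>"
      "\<forall>y\<in>underS lam \<rho>. (x, y) \<in> lam \<longrightarrow> \<nu> \<in> U (c y)" ..
    from bdd[OF x(1)] obtain \<gamma> where \<gamma>: "\<gamma> \<in> U \<alpha>" "{g\<in>G. (r g, x) \<in> lam} \<subseteq> U \<gamma>" ..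
    have "\<nu> \<in> U ((c \<circ> r) g)" if g: "g \<in> ?G'" "\<gamma> \<in> U g" for g
    proof -
      have "(r g, x) \<notin> lam" using g \<gamma> U_asym by blast
      then have "(x, r g) \<in> lam"
        using lam_total[OF underS_FieldD(1)[OF x(1)] r[of g]] Well_order_lam r[of g] g
        by (auto simp: underS_def order_on_defs refl_on_def)
      then show ?thesis using x(2) g by simp
    qed
    then show "\<exists>\<gamma>\<in>U \<alpha>. \<forall>g\<in>?G'. \<gamma> \<in> U g \<longrightarrow> \<nu> \<in> U ((c \<circ> r) g)" using \<gamma>(1) by blast
  qed
  ultimately show ?thesis using rho G' by (auto simp: Q_def)
qed

section \<open>Carrying the guesses at \<open>\<alpha>\<^sub>0\<close> to other points\<close>

text \<open>The new guessing functions have parameters \<open>(\<mu>, \<rho>, i)\<close>. There are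
  at most \<open>lam\<close> of these, so they can be coded below \<open>j\<close>, and hence below
  every \<open>\<alpha>\<close> above \<open>j\<close>.\<close>

lemma ex_triple_enumeration:
  "\<exists>\<tau>. Field lam \<times> Field lam \<times> U \<alpha>\<^sub>0 \<subseteq> \<tau> ` U j"
proof -
  have a: "|U \<alpha>\<^sub>0| \<le>o lam" using card_U E_Field \<alpha>\<^sub>0 by blast
  have l: "|Field lam| \<le>o lam" using card_of_Field_ordIso[OF lam] ordIso_imp_ordLeq by blast
  have "|Field lam \<times> Field lam \<times> U \<alpha>\<^sub>0| \<le>o lam"
    using card_of_Times_ordLeq_infinite_Field[OF inf_lam l card_of_Times_ordLeq_infinite_Field[OF inf_lam l a lam] lam] .
  then have "|Field lam \<times> Field lam \<times> U \<alpha>\<^sub>0| \<le>o |U j|"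
    by (rule ordLeq_ordIso_trans[OF _ ordIso_symmetric[OF j(2)]])
  moreover have "Field lam \<times> Field lam \<times> U \<alpha>\<^sub>0 \<noteq> {}" using inf_lam \<alpha>\<^sub>0 by auto
  ultimately have "\<exists>\<tau>. \<tau> ` U j = Field lam \<times> Field lam \<times> U \<alpha>\<^sub>0"
    by (rule card_of_ordLeq2[THEN iffD2, rotated])
  then show ?thesis by blast
qed

text \<open>The argument common to both halves of the theorem. A point \<open>b\<close> is sent to
  \<open>\<xi> = c \<rho> (r \<mu> b)\<close> below \<open>\<alpha>\<^sub>0\<close>, and the guess
  of \<open>F i\<close> at \<open>\<xi>\<close> becomes a guess at \<open>b\<close> by matching
  positions in the enumerations \<open>e \<xi>\<close> and \<open>e b\<close>.\<close>

lemma Jideal_if_bounded_fibers: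
  assumes S: "S \<subseteq> Ecof k th" and C: "club k C"
    and r: "\<And>\<mu> b. \<mu> \<in> Field lam \<Longrightarrow> r \<mu> b \<in> Field lam"
    and fib: "\<And>\<alpha> B. \<alpha> \<in> S \<inter> C \<Longrightarrow> sup_is k B \<alpha> \<Longrightarrow>
      \<exists>G\<subseteq>B. sup_is k G \<alpha> \<and> (\<forall>\<gamma>\<in>U \<alpha>. |G \<inter> U \<gamma>| <o th) \<and>
        (\<exists>\<mu>\<in>Field lam. \<forall>v. \<not> sup_is k {g\<in>G. r \<mu> g = v} \<alpha>)"
  shows "S \<in> Jideal k"
proof -
  obtain \<tau> where \<tau>: "Field lam \<times> Field lam \<times> U \<alpha>\<^sub>0 \<subseteq> \<tau> ` U j" using ex_triple_enumeration by blast
  \<comment> \<open>One ladder per length, fixed before any \<open>\<alpha>\<close> is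
    considered.\<close>
  define c where "c \<rho> = (SOME c. ladder \<rho> c)" for \<rho>
  \<comment> \<open>The guess at \<open>b\<close> is what \<open>e b\<close> lists at the position
    where \<open>e \<xi>\<close> lists the guess of \<open>F i\<close>. The conjunct
    \<open>j \<in> U \<xi>\<close> makes \<open>e \<xi>\<close> injective, so that at most one
    \<open>z\<close> results.\<close>
  define H where "H = (\<lambda>(\<mu>, \<rho>, i) b. let \<xi> = c \<rho> (r \<mu> b) in
    {z. \<exists>x\<in>Field lam. z = e b x \<and> e \<xi> x \<in> F i \<xi> \<and> j \<in> U \<xi> \<and> \<xi> \<in> U \<alpha>\<^sub>0 \<and> i \<in> U \<alpha>\<^sub>0 \<and> z \<in> Field k})"
  have H1: "H p b = {} \<or> (\<exists>x\<in>Field k. H p b = {x})" for p b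
  proof -
    have "x = y" if H: "x \<in> H p b" "y \<in> H p b" for x y
    proof -
      obtain \<mu> \<rho> i where p: "p = (\<mu>, \<rho>, i)" by (cases p)
      define \<xi> where "\<xi> = c \<rho> (r \<mu> b)"
      obtain x' where x': "x' \<in> Field lam" "x = e b x'" "e \<xi> x' \<in> F i \<xi>"
        and i: "j \<in> U \<xi>" "\<xi> \<in> U \<alpha>\<^sub>0" "i \<in> U \<alpha>\<^sub>0"
        using H(1) unfolding H_def p \<xi>_def Let_def prod.case by blast
      obtain y' where y': "y' \<in> Field lam" "y = e b y'" "e \<xi> y' \<in> F i \<xi>"
        using H(2) unfolding H_def p \<xi>_def Let_def prod.case by blast
      have "e \<xi> x' = e \<xi> y'"
        by (rule F_sub[OF underS_FieldD(1)[OF i(3)] underS_FieldD(1)[OF i(2)] x'(3) y'(3)])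
      then have "x' = y'" by (rule inj_onD[OF e_inj[OF i(1)] _ x'(1) y'(1)])
      then show ?thesis using x' y' by simp
    qed
    moreover have "H p b \<subseteq> Field k" by (auto simp: H_def Let_def split: prod.splits)
    ultimately show ?thesis by blast
  qed
  have main: "\<exists>i\<in>U \<alpha>. sup_is k {\<beta>\<in>B. f \<beta> \<in> H (\<tau> i) \<beta>} \<alpha>"
    if \<alpha>: "\<alpha> \<in> S" "\<alpha> \<in> C" "j \<in> U \<alpha>" and f: "regressive k f \<alpha>" and B: "sup_is k B \<alpha>" for \<alpha> f B
  proof -
    have E: "\<alpha> \<in> Ecof k th" using \<alpha> S by blast
    \<comment> \<open>Cutting \<open>B\<close> above \<open>j\<close> makes \<open>U b\<close>
      nonempty for its points \<open>b\<close>, so that \<open>f b\<close> is strictly below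
      \<open>b\<close>.\<close>
    from fib[OF IntI[OF \<alpha>(1,2)] sup_tail[OF E B \<alpha>(3)]]
    obtain G \<mu> where G: "G \<subseteq> {b\<in>B. j \<in> U b}" "sup_is k G \<alpha>" "\<forall>\<gamma>\<in>U \<alpha>. |G \<inter> U \<gamma>| <o th"
      and \<mu>: "\<mu> \<in> Field lam" "\<forall>v. \<not> sup_is k {g\<in>G. r \<mu> g = v} \<alpha>"
      by (elim exE conjE bexE)
    have G3: "\<And>\<gamma>. \<gamma> \<in> U \<alpha> \<Longrightarrow> |G \<inter> U \<gamma>| <o th" by (rule bspec[OF G(3)])
    have "\<exists>\<rho>\<in>Field lam. sup_is k {g\<in>G. r \<mu> g \<in> underS lam \<rho>} \<alpha> \<and> (\<exists>c. ladder \<rho> c) \<and>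
        (\<forall>c. ladder \<rho> c \<longrightarrow> tends {g\<in>G. r \<mu> g \<in> underS lam \<rho>} \<alpha> (c \<circ> r \<mu>) \<alpha>\<^sub>0)"
      by (rule ex_ladder[OF E G(2) G3 r[OF \<mu>(1)] spec[OF \<mu>(2)]])
    then obtain \<rho> where \<rho>: "\<rho> \<in> Field lam" "\<exists>c. ladder \<rho> c"
      and G': "sup_is k {g\<in>G. r \<mu> g \<in> underS lam \<rho>} \<alpha>"
      and t: "\<forall>c. ladder \<rho> c \<longrightarrow> tends {g\<in>G. r \<mu> g \<in> underS lam \<rho>} \<alpha> (c \<circ> r \<mu>) \<alpha>\<^sub>0"
      by (elim bexE conjE)
    let ?G = "{g\<in>G. r \<mu> g \<in> underS lam \<rho>}"
    define s where "s = c \<rho> \<circ> r \<mu>"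
    have s: "tends ?G \<alpha> s \<alpha>\<^sub>0"
      using t \<rho>(2) unfolding s_def c_def by (metis someI_ex)
    have small: "|?G \<inter> U \<gamma>| <o th" if "\<gamma> \<in> U \<alpha>" for \<gamma>
    proof -
      have "?G \<inter> U \<gamma> \<subseteq> G \<inter> U \<gamma>" by blast
      then show ?thesis by (rule card_subset_less[OF _ G3[OF that]])
    qed
    define u where "u = inv_into ?G s"
    have u: "u \<xi> \<in> ?G \<and> s (u \<xi>) = \<xi>" if "\<xi> \<in> s ` ?G" for \<xi>
      using that inv_into_into[of \<xi> s ?G] f_inv_into_f[of \<xi> s ?G] by (simp add: u_def)
    have uU: "u \<xi> \<in> U \<alpha> \<and> j \<in> U (u \<xi>) \<and> u \<xi> \<in> B" if "\<xi> \<in> s ` ?G" for \<xi>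
      using u[OF that] G(1,2) by (auto simp: sup_is_iff)
    have "\<exists>x\<in>Field lam. e (u \<xi>) x = f (u \<xi>)" if "\<xi> \<in> s ` ?G" for \<xi>
    proof -
      have "f (u \<xi>) \<in> U (u \<xi>)"
        using uU[OF that] f by (auto simp: regressive_def olt_iff_underS)
      then show ?thesis by (rule e_ex)
    qed
    then obtain x where x: "\<And>\<xi>. \<xi> \<in> s ` ?G \<Longrightarrow> x \<xi> \<in> Field lam \<and> e (u \<xi>) (x \<xi>) = f (u \<xi>)"
      by metis
    \<comment> \<open>Copying \<open>f\<close> to \<open>\<alpha>\<^sub>0\<close>: the value at
      \<open>\<xi>\<close> is what \<open>e \<xi>\<close> lists at position \<open>x \<xi>\<close>,
      where \<open>e (u \<xi>)\<close> lists \<open>f (u \<xi>)\<close>. Off the image of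
      \<open>s\<close> any regressive value will do.\<close>
    have "\<exists>y. y \<in> U \<alpha>\<^sub>0 \<and> (U \<xi> \<noteq> {} \<longrightarrow> y \<in> U \<xi>) \<and> (\<xi> \<in> s ` ?G \<and> U \<xi> \<noteq> {} \<longrightarrow> y = e \<xi> (x \<xi>))"
      if "\<xi> \<in> U \<alpha>\<^sub>0" for \<xi>
    proof (cases "U \<xi> = {}")
      case True
      then show ?thesis using that by blast
    next
      case False
      then have "\<xi> \<in> s ` ?G \<Longrightarrow> e \<xi> (x \<xi>) \<in> U \<xi>" using x e_in by blast
      then show ?thesis using False that U_trans by (metis ex_in_conv)
    qed
    then obtain f' where f': "\<And>\<xi>. \<xi> \<in> U \<alpha>\<^sub>0 \<Longrightarrow> f' \<xi> \<in> U \<alpha>\<^sub>0 \<and> (U \<xi> \<noteq> {} \<longrightarrow> f' \<xi> \<in> U \<xi>) \<and>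
        (\<xi> \<in> s ` ?G \<and> U \<xi> \<noteq> {} \<longrightarrow> f' \<xi> = e \<xi> (x \<xi>))" by metis
    then have "regressive k f' \<alpha>\<^sub>0" by (auto simp: regressive_def olt_iff_underS)
    then obtain i where i: "i \<in> U \<alpha>\<^sub>0" "sup_is k {\<xi>\<in>s ` ?G. f' \<xi> \<in> F i \<xi>} \<alpha>\<^sub>0"
      using F_guess tends_sup_image[OF s G'] by blast
    \<comment> \<open>Keeping only points above \<open>j\<close> secures the conjunct
      \<open>j \<in> U \<xi>\<close> of \<open>H\<close>.\<close>
    define K where "K = {\<xi>\<in>{\<xi>\<in>s ` ?G. f' \<xi> \<in> F i \<xi>}. j \<in> U \<xi>}"
    have K: "sup_is k K \<alpha>\<^sub>0" unfolding K_def by (rule sup_tail[OF \<alpha>\<^sub>0(1) i(2) \<alpha>\<^sub>0(2)])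
    have "sup_is k (u ` K) \<alpha>"
      by (rule tends_sup_section[where t = s, OF E \<alpha>\<^sub>0(1) G' small _ K]) (use u in \<open>auto simp: K_def\<close>)
    moreover obtain l where l: "l \<in> U j" "\<tau> l = (\<mu>, \<rho>, i)" using \<tau> \<mu> \<rho> i by (auto simp: image_iff dest!: subsetD[where c = "(\<mu>, \<rho>, i)"])
    have "u ` K \<subseteq> {\<beta>\<in>B. f \<beta> \<in> H (\<tau> l) \<beta>}"
    proof clarify
      fix \<xi> assume xi: "\<xi> \<in> K"
      then have xiG: "\<xi> \<in> s ` ?G" and F: "f' \<xi> \<in> F i \<xi>" and jx: "j \<in> U \<xi>" by (auto simp: K_def)
      have xiU: "\<xi> \<in> U \<alpha>\<^sub>0" using K xi by (auto simp: sup_is_iff)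
      have c: "c \<rho> (r \<mu> (u \<xi>)) = \<xi>" using u[OF xiG] by (simp add: s_def)
      have "f (u \<xi>) \<in> U \<alpha>" using f uU[OF xiG] by (auto simp: regressive_def)
      then have "f (u \<xi>) \<in> Field k" by (rule underS_FieldD(1))
      moreover have "e \<xi> (x \<xi>) \<in> F i \<xi>" using f'[OF xiU] xiG jx F by auto
      ultimately have "f (u \<xi>) \<in> H (\<tau> l) (u \<xi>)"
        using x[OF xiG] jx xiU i(1) by (auto simp: H_def l(2) Let_def c intro!: bexI[of _ "x \<xi>"])
      then show "u \<xi> \<in> B \<and> f (u \<xi>) \<in> H (\<tau> l) (u \<xi>)" using uU[OF xiG] by blast
    qed
    ultimately have "sup_is k {\<beta>\<in>B. f \<beta> \<in> H (\<tau> l) \<beta>} \<alpha>"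
      by (rule sup_between[OF E _ _ _ B]) auto
    then show ?thesis using U_trans[OF l(1) \<alpha>(3)] by blast
  qed
  show ?thesis unfolding Jideal_def
  proof (intro CollectI conjI exI[of _ "{\<beta>\<in>C. j \<in> U \<beta>}"] exI[of _ "\<lambda>i. H (\<tau> i)"] ballI allI impI)
    show "S \<subseteq> Field k" using S E_Field by blast
    show "club k {\<beta>\<in>C. j \<in> U \<beta>}" using club_tail C j by blast
    show "H (\<tau> i) \<beta> = {} \<or> (\<exists>x\<in>Field k. H (\<tau> i) \<beta> = {x})" for i \<beta> by (rule H1)
  next
    fix \<alpha> f B
    assume a: "\<alpha> \<in> S \<inter> {\<beta>\<in>C. j \<in> U \<beta>}" "regressive k f \<alpha> \<and> cofinal_sub k B \<alpha>"
    then have "sup_is k B \<alpha>" using E_cofinal_iff S by blast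
    then show "\<exists>i\<in>U \<alpha>. sup_is k {\<beta>\<in>B. f \<beta> \<in> H (\<tau> i) \<beta>} \<alpha>" using main a by blast
  qed
qed

end

section \<open>Colourings with bounded fibres\<close>

context succ_card begin

text \<open>Thin an enumeration of a cofinal set along \<open>th\<close> to its record values. These
  increase with their indices, so those below a given \<open>\<gamma>\<close> come from a proper
  initial segment of \<open>th\<close>, which has fewer than \<open>th\<close> elements.\<close>

lemma ex_small_cofinal:
  assumes \<alpha>: "\<alpha> \<in> Ecof k th"
  shows "\<exists>A. sup_is k A \<alpha> \<and> |A| \<le>o th \<and> (\<forall>\<gamma>\<in>U \<alpha>. |A \<inter> U \<gamma>| <o th)"
proof -
  obtain A\<^sub>0 where A0: "sup_is k A\<^sub>0 \<alpha>" "|A\<^sub>0| =o th" using E_ex_cofinal[OF \<alpha>] by blast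
  have "|Field th| =o |A\<^sub>0|"
    by (rule ordIso_transitive[OF card_of_Field_ordIso[OF th] ordIso_symmetric[OF A0(2)]])
  then obtain f where "bij_betw f (Field th) A\<^sub>0" using card_of_ordIso by blast
  then have f: "f ` Field th = A\<^sub>0" by (simp add: bij_betw_def)
  \<comment> \<open>the indices at which the enumeration exceeds all its earlier values\<close>
  define R where "R = {\<xi>\<in>Field th. \<forall>\<zeta>\<in>underS th \<xi>. f \<zeta> \<in> U (f \<xi>)}"
  have wo: "Well_order th" using th by (simp add: card_order_on_def)
  have A: "f ` R \<subseteq> A\<^sub>0" using f by (auto simp: R_def)
  have sup: "sup_is k (f ` R) \<alpha>" unfolding sup_is_iff
  proof (intro conjI ballI)
    show "f ` R \<subseteq> U \<alpha>" using A A0 by (auto simp: sup_is_iff)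
    fix \<gamma> assume g: "\<gamma> \<in> U \<alpha>"
    define Q where "Q = {\<xi>\<in>Field th. \<gamma> \<in> U (f \<xi>)}"
    have "\<exists>a\<in>A\<^sub>0. \<gamma> \<in> U a" using A0(1) g by (simp add: sup_is_iff)
    then obtain \<xi>\<^sub>0 where "\<xi>\<^sub>0 \<in> Q" using f by (auto simp: Q_def)
    then obtain \<xi> where xi: "\<xi> \<in> Q" and min: "\<And>\<zeta>. (\<zeta>, \<xi>) \<in> {(x, y). x \<in> underS th y} \<Longrightarrow> \<zeta> \<notin> Q"
      using wfE_min[OF wf_underS[OF wo]] by metis
    \<comment> \<open>The least index with value beyond \<open>\<gamma>\<close> is a record, since
      all earlier values are at most \<open>\<gamma>\<close>.\<close>
    have "f \<zeta> \<in> U (f \<xi>)" if z: "\<zeta> \<in> underS th \<xi>" for \<zeta>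
    proof -
      have zF: "\<zeta> \<in> Field th" by (rule underS_FieldD(1)[OF z])
      have "f \<zeta> \<in> A\<^sub>0" using f zF by blast
      then have "f \<zeta> \<in> U \<alpha>" using A0(1) by (auto simp: sup_is_iff)
      moreover have "\<gamma> \<notin> U (f \<zeta>)" using min[of \<zeta>] z zF by (simp add: Q_def)
      ultimately have "f \<zeta> = \<gamma> \<or> f \<zeta> \<in> U \<gamma>"
        using U_total[OF underS_FieldD(1)[OF g], of "f \<zeta>"] underS_FieldD(1)[of "f \<zeta>" k \<alpha>] by blast
      moreover have "\<gamma> \<in> U (f \<xi>)" using xi by (simp add: Q_def)
      ultimately show ?thesis using U_trans[of "f \<zeta>" \<gamma> "f \<xi>"] by blast
    qed
    then have "\<xi> \<in> R" using xi by (simp add: R_def Q_def)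
    then show "\<exists>\<beta>\<in>f ` R. \<gamma> \<in> U \<beta>" using xi by (auto simp: Q_def)
  qed
  moreover have "|f ` R| \<le>o th" by (rule ordLeq_ordIso_trans[OF card_of_mono1[OF A] A0(2)])
  moreover have "|f ` R \<inter> U \<gamma>| <o th" if "\<gamma> \<in> U \<alpha>" for \<gamma>
  proof -
    have "\<exists>a\<in>f ` R. \<gamma> \<in> U a" using sup that by (simp add: sup_is_iff)
    then obtain \<xi> where xi: "\<xi> \<in> R" "\<gamma> \<in> U (f \<xi>)" by blast
    then have xiF: "\<xi> \<in> Field th" by (simp add: R_def)
    have "f ` R \<inter> U \<gamma> \<subseteq> f ` underS th \<xi>"
    proof clarify
      fix \<zeta> assume z: "\<zeta> \<in> R" "f \<zeta> \<in> U \<gamma>"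
      have fz: "f \<zeta> \<in> U (f \<xi>)" by (rule U_trans[OF z(2) xi(2)])
      then have n: "f \<xi> \<notin> U (f \<zeta>)" by (rule U_asym)
      then have "\<zeta> \<noteq> \<xi>" using fz by metis
      moreover have "\<xi> \<notin> underS th \<zeta>" using z(1) n by (auto simp: R_def)
      ultimately have "\<zeta> \<in> underS th \<xi>" using underS_total[OF wo xiF, of \<zeta>] z(1) by (auto simp: R_def)
      then show "f \<zeta> \<in> f ` underS th \<xi>" by blast
    qed
    then show ?thesis by (rule card_subset_less[OF _ card_image_less[OF card_of_underS[OF th xiF]]])
  qed
  ultimately show ?thesis by blast
qed

lemma sup_image_above:
  assumes "sup_is k H \<alpha>" "p ` H \<subseteq> U \<alpha>" "\<And>g. g \<in> H \<Longrightarrow> g \<in> U (p g)"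
  shows "sup_is k (p ` H) \<alpha>"
  unfolding sup_is_iff
proof (intro conjI ballI assms(2))
  fix \<gamma> assume "\<gamma> \<in> U \<alpha>"
  then have "\<exists>g\<in>H. \<gamma> \<in> U g" using assms(1) by (simp add: sup_is_iff)
  then obtain g where g: "g \<in> H" "\<gamma> \<in> U g" ..
  then show "\<exists>\<beta>\<in>p ` H. \<gamma> \<in> U \<beta>" using U_trans[OF g(2) assms(3)[OF g(1)]] by blast
qed

text \<open>If \<open>p g\<close> is below \<open>\<gamma>\<close>, so is \<open>g\<close>.\<close>

lemma small_image_above:
  assumes "|A \<inter> U \<gamma>| <o th" "H \<subseteq> A" "\<And>g. g \<in> A \<Longrightarrow> g \<in> U (p g)"
  shows "|p ` H \<inter> U \<gamma>| <o th"
proof (rule card_subset_less[OF _ card_image_less[OF assms(1)]])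
  show "p ` H \<inter> U \<gamma> \<subseteq> p ` (A \<inter> U \<gamma>)" using assms(2,3) U_trans by blast
qed

lemma colorsD:
  assumes "colors e a r" "\<mu> \<in> Field lam" "x \<in> U y" "(x, y) \<in> (closure_step e a \<mu>)\<^sup>*"
  shows "r \<mu> x \<noteq> r \<mu> y"
  using assms by (simp add: colors_def)

end

context J_point begin

text \<open>Interleave \<open>B\<close> with \<open>A\<close>: for \<open>\<gamma>\<close> in
  \<open>A\<close>, the point \<open>p \<gamma>\<close> of \<open>B\<close> lies above
  \<open>\<gamma>\<close> and above the code \<open>c \<gamma>\<close> of
  \<open>A \<inter> U \<gamma>\<close>, and \<open>q \<gamma>\<close> in \<open>A\<close> lies above
  \<open>p \<gamma>\<close>. At a level \<open>\<mu>\<close> that suffices for cofinally many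
  \<open>\<gamma>\<close>, \<open>p \<gamma>\<close> is in the closure of \<open>p \<delta>\<close>
  once \<open>\<delta>\<close> exceeds \<open>q \<gamma>\<close>, so the two get different
  colours.\<close>

lemma bounded_fibers_if_approachable:
  assumes r: "colors e a r" and \<alpha>: "\<alpha> \<in> Ecof k th" and A: "sup_is k A \<alpha>"
    and small: "\<And>\<gamma>. \<gamma> \<in> U \<alpha> \<Longrightarrow> |A \<inter> U \<gamma>| <o th"
    and app: "\<And>\<gamma>. \<gamma> \<in> U \<alpha> \<Longrightarrow> \<exists>\<beta>\<in>U \<alpha>. A \<inter> U \<gamma> = a \<beta>"
    and B: "sup_is k B \<alpha>"
  shows "\<exists>G\<subseteq>B. sup_is k G \<alpha> \<and> (\<forall>\<gamma>\<in>U \<alpha>. |G \<inter> U \<gamma>| <o th) \<and>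
    (\<exists>\<mu>\<in>Field lam. \<forall>v. \<not> sup_is k {g\<in>G. r \<mu> g = v} \<alpha>)"
proof -
  have AU: "A \<subseteq> U \<alpha>" and BU: "B \<subseteq> U \<alpha>" using A B by (auto simp: sup_is_iff)
  have "\<exists>c b q m. A \<inter> U \<gamma> = a c \<and> b \<in> B \<and> \<gamma> \<in> U b \<and> q \<in> A \<and> b \<in> U q \<and> m \<in> Field lam \<and>
      (c, b) \<in> closure_step e a m \<and> (b, q) \<in> closure_step e a m" if "\<gamma> \<in> A" for \<gamma>
  proof -
    have g: "\<gamma> \<in> U \<alpha>" using that AU by blast
    obtain c where c: "c \<in> U \<alpha>" "A \<inter> U \<gamma> = a c" using app[OF g] by blast
    obtain \<delta> where d: "\<delta> \<in> U \<alpha>" "\<gamma> \<in> U \<delta>" "c \<in> U \<delta>" using E_max[OF \<alpha> g c(1)] by blast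
    have "\<exists>b\<in>B. \<delta> \<in> U b" using B d(1) by (simp add: sup_is_iff)
    then obtain b where b: "b \<in> B" "\<delta> \<in> U b" ..
    have "\<exists>q\<in>A. b \<in> U q" using A b(1) BU by (auto simp: sup_is_iff)
    then obtain q where q: "q \<in> A" "b \<in> U q" ..
    obtain \<eta> where \<eta>: "\<eta> \<in> Field lam" "e b \<eta> = c" using e_ex[OF U_trans[OF d(3) b(2)]] ..
    obtain \<eta>' where \<eta>': "\<eta>' \<in> Field lam" "e q \<eta>' = b" using e_ex[OF q(2)] ..
    obtain m where m: "m \<in> Field lam" "\<eta> \<in> underS lam m" "\<eta>' \<in> underS lam m"
      using lam_bound2[OF \<eta>(1) \<eta>'(1)] by blast
    have "(c, b) \<in> closure_step e a m" "(b, q) \<in> closure_step e a m"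
      using \<eta>(2) \<eta>'(2) m by (auto simp: closure_step_def)
    then show ?thesis using c(2) b(1) U_trans[OF d(2) b(2)] q m(1) by blast
  qed
  then obtain c p q m where cpqm: "\<forall>\<gamma>\<in>A. A \<inter> U \<gamma> = a (c \<gamma>) \<and> p \<gamma> \<in> B \<and> \<gamma> \<in> U (p \<gamma>) \<and> q \<gamma> \<in> A \<and>
      p \<gamma> \<in> U (q \<gamma>) \<and> m \<gamma> \<in> Field lam \<and>
      (c \<gamma>, p \<gamma>) \<in> closure_step e a (m \<gamma>) \<and> (p \<gamma>, q \<gamma>) \<in> closure_step e a (m \<gamma>)"
    by metis
  have above: "\<gamma> \<in> U (p \<gamma>)" if "\<gamma> \<in> A" for \<gamma> using cpqm that by blast
  \<comment> \<open>The level \<open>m \<gamma>\<close> varies with \<open>\<gamma>\<close>;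
    \<open>bounded_on_cofinal\<close> gives one \<open>\<mu>\<close> above it for cofinally many
    \<open>\<gamma>\<close>.\<close>
  have "\<exists>x\<in>Field lam. sup_is k {g\<in>A. m g \<in> underS lam x} \<alpha>"
    by (rule bounded_on_cofinal[OF \<alpha> A small]) (use cpqm in blast)+
  then obtain \<mu> where \<mu>: "\<mu> \<in> Field lam" "sup_is k {g\<in>A. m g \<in> underS lam \<mu>} \<alpha>" ..
  let ?H = "{g\<in>A. m g \<in> underS lam \<mu>}" and ?R = "(closure_step e a \<mu>)\<^sup>*"
  have GB: "p ` ?H \<subseteq> B" using cpqm by blast
  then have sup: "sup_is k (p ` ?H) \<alpha>"
    by (intro sup_image_above[OF \<mu>(2)]) (use BU above in auto)
  have smallG: "|p ` ?H \<inter> U \<gamma>| <o th" if "\<gamma> \<in> U \<alpha>" for \<gamma>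
    by (rule small_image_above[OF small[OF that] _ above]) auto
  have "\<not> sup_is k {g\<in>p ` ?H. r \<mu> g = v} \<alpha>" for v
  proof
    let ?F = "{g\<in>p ` ?H. r \<mu> g = v}"
    assume F: "sup_is k ?F \<alpha>"
    have "\<exists>g. g \<in> ?F" using F E_ne[OF \<alpha>] unfolding sup_is_iff by blast
    then obtain \<gamma> where g: "\<gamma> \<in> ?H" "r \<mu> (p \<gamma>) = v" by auto
    then have qA: "q \<gamma> \<in> A" and pq: "p \<gamma> \<in> U (q \<gamma>)" using cpqm by auto
    \<comment> \<open>As \<open>p\<close> may fail to be monotone, \<open>\<delta>\<close> is pushed
      up indirectly: \<open>\<epsilon>\<close> bounds the values of \<open>p\<close> on
      \<open>A \<inter> U \<delta>\<^sub>0\<close>, so \<open>p \<delta>\<close> beyond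
      \<open>\<epsilon>\<close> forces \<open>\<delta>\<close> to be at least
      \<open>\<delta>\<^sub>0\<close>, hence beyond \<open>q \<gamma>\<close>.\<close>
    obtain \<delta>\<^sub>0 where d0: "\<delta>\<^sub>0 \<in> U \<alpha>" "q \<gamma> \<in> U \<delta>\<^sub>0" using E_limit[OF \<alpha>, of "q \<gamma>"] qA AU by blast
    have "p ` (A \<inter> U \<delta>\<^sub>0) \<subseteq> U \<alpha>" using cpqm BU by blast
    then obtain \<epsilon> where \<epsilon>: "\<epsilon> \<in> U \<alpha>" "p ` (A \<inter> U \<delta>\<^sub>0) \<subseteq> U \<epsilon>"
      using E_small_bounded[OF \<alpha> _ card_image_less[OF small[OF d0(1)]]] by blast
    have "\<exists>b\<in>?F. \<epsilon> \<in> U b" using F \<epsilon>(1) unfolding sup_is_iff by blast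
    then obtain \<delta> where d: "\<delta> \<in> ?H" "r \<mu> (p \<delta>) = v" "\<epsilon> \<in> U (p \<delta>)" by auto
    then have dA: "\<delta> \<in> A" by simp
    have "\<delta> \<notin> U \<delta>\<^sub>0" using U_asym[OF d(3)] \<epsilon>(2) dA by blast
    moreover have "\<delta> \<in> Field k" using underS_FieldD(1)[of \<delta> k \<alpha>] dA AU by blast
    ultimately have "\<delta>\<^sub>0 = \<delta> \<or> \<delta>\<^sub>0 \<in> U \<delta>" using U_total[OF underS_FieldD(1)[OF d0(1)]] by blast
    then have qd: "q \<gamma> \<in> U \<delta>" using d0(2) U_trans[OF d0(2)] by blast
    have "p \<gamma> \<in> U (p \<delta>)" by (rule U_trans[OF U_trans[OF pq qd] above[OF dA]])
    \<comment> \<open>the path \<open>p \<gamma>\<close>, \<open>q \<gamma>\<close>, \<open>c \<delta>\<close>, \<open>p \<delta>\<close>; its middle step holds because \<open>q \<gamma>\<close> lies in the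
      initial segment \<open>A \<inter> U \<delta>\<close>, which is coded by \<open>c \<delta>\<close>\<close>
    moreover have "(p \<gamma>, p \<delta>) \<in> ?R"
    proof -
      have "(p \<gamma>, q \<gamma>) \<in> closure_step e a (m \<gamma>)" "(c \<delta>, p \<delta>) \<in> closure_step e a (m \<delta>)"
        using cpqm g(1) d(1) by auto
      then have "(p \<gamma>, q \<gamma>) \<in> ?R" "(c \<delta>, p \<delta>) \<in> ?R"
        using g(1) d(1) subsetD[OF closure_step_mono] by blast+
      moreover have "A \<inter> U \<delta> = a (c \<delta>)" using cpqm dA by blast
      then have "(q \<gamma>, c \<delta>) \<in> closure_step e a \<mu>"
        using qd qA small[of \<delta>] dA AU by (auto simp: closure_step_def)
      ultimately show ?thesis by (meson r_into_rtrancl rtrancl_trans)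
    qed
    ultimately show False using colorsD[OF r \<mu>(1)] g(2) d(2) by metis
  qed
  then show ?thesis using GB sup smallG \<mu>(1) by blast
qed

text \<open>\<open>G\<close> has at most \<open>th\<close> points, so there are at most
  \<open>th\<close> positions of one of them in the enumeration of another; as
  \<open>th <o lam\<close>, regularity puts all these below one \<open>\<mu>\<close>. Any two points
  of \<open>G\<close> are then one closure step apart, so \<open>r \<mu>\<close> is injective on
  \<open>G\<close>.\<close>

lemma bounded_fibers_if_regular:
  assumes reg: "regularCard lam" and r: "colors e a r" and \<alpha>: "\<alpha> \<in> Ecof k th" and B: "sup_is k B \<alpha>"
  shows "\<exists>G\<subseteq>B. sup_is k G \<alpha> \<and> (\<forall>\<gamma>\<in>U \<alpha>. |G \<inter> U \<gamma>| <o th) \<and>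
    (\<exists>\<mu>\<in>Field lam. \<forall>v. \<not> sup_is k {g\<in>G. r \<mu> g = v} \<alpha>)"
proof -
  obtain A where A: "sup_is k A \<alpha>" "|A| \<le>o th" and small: "\<forall>\<gamma>\<in>U \<alpha>. |A \<inter> U \<gamma>| <o th"
    using ex_small_cofinal[OF \<alpha>] by blast
  have "\<exists>b\<in>B. g \<in> U b" if "g \<in> A" for g using A(1) B that by (auto simp: sup_is_iff)
  then obtain p where p: "\<And>g. g \<in> A \<Longrightarrow> p g \<in> B" "\<And>g. g \<in> A \<Longrightarrow> g \<in> U (p g)" by metis
  define G where "G = p ` A"
  have GB: "G \<subseteq> B" using p(1) by (auto simp: G_def)
  have sup: "sup_is k G \<alpha>" unfolding G_def
    by (rule sup_image_above[OF A(1) _ p(2)]) (use GB B in \<open>auto simp: sup_is_iff G_def\<close>)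
  have smallG: "|G \<inter> U \<gamma>| <o th" if "\<gamma> \<in> U \<alpha>" for \<gamma>
    unfolding G_def by (rule small_image_above[OF bspec[OF small that] _ p(2)]) auto
  \<comment> \<open>The position of \<open>b\<close> in \<open>e b'\<close>, with an arbitrary
    default in \<open>Field lam\<close> when \<open>b\<close> is not below \<open>b'\<close>, so
    that \<open>?Y\<close> stays inside \<open>Field lam\<close>.\<close>
  have "\<exists>\<eta>\<in>Field lam. b \<in> U b' \<longrightarrow> e b' \<eta> = b" for b b'
    using e_ex[of b b'] inf_lam by (cases "b \<in> U b'") (auto simp: ex_in_conv)
  then obtain \<eta> where \<eta>: "\<And>b b'. \<eta> b b' \<in> Field lam" "\<And>b b'. b \<in> U b' \<Longrightarrow> e b' (\<eta> b b') = b" by metis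
  let ?Y = "case_prod \<eta> ` (G \<times> G)"
  have "|G| \<le>o th" unfolding G_def by (rule ordLeq_transitive[OF card_of_image A(2)])
  then have "|G \<times> G| \<le>o th" using card_of_Times_ordLeq_infinite_Field[OF inf_th _ _ th] by blast
  then have "|?Y| <o lam" by (rule card_image_less[OF ordLeq_ordLess_trans[OF _ th_lam]])
  then have "\<not> |?Y| =o lam" using not_ordLess_ordIso by blast
  moreover have "?Y \<subseteq> Field lam" using \<eta>(1) by auto
  ultimately have "\<not> cofinal ?Y lam" using reg unfolding regularCard_def by blast
  then obtain x where x: "x \<in> Field lam" "\<forall>y\<in>?Y. x \<notin> underS lam y"
    unfolding cofinal_def underS_def by blast
  \<comment> \<open>The bound \<open>x\<close> may itself belong to \<open>?Y\<close>, whereas the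
    closure at level \<open>\<mu>\<close> uses only positions strictly below \<open>\<mu>\<close>;
    hence one step up.\<close>
  obtain \<mu> where \<mu>: "\<mu> \<in> Field lam" "x \<in> underS lam \<mu>" using lam_no_max[OF x(1)] ..
  have Y: "y \<in> underS lam \<mu>" if "y \<in> ?Y" for y
  proof -
    have "y \<in> Field lam" using that \<eta>(1) by auto
    then have "y = x \<or> y \<in> underS lam x" using lam_total[OF x(1)] bspec[OF x(2) that] by blast
    then show ?thesis using \<mu>(2) lam_trans[OF _ \<mu>(2)] by blast
  qed
  have "\<not> sup_is k {g\<in>G. r \<mu> g = v} \<alpha>" for v
  proof
    let ?F = "{g\<in>G. r \<mu> g = v}"
    assume F: "sup_is k ?F \<alpha>"
    have "\<exists>b. b \<in> ?F" using F E_ne[OF \<alpha>] unfolding sup_is_iff by blast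
    then obtain b where b: "b \<in> ?F" ..
    then have "\<exists>b'\<in>?F. b \<in> U b'" using F unfolding sup_is_iff by blast
    then obtain b' where b': "b' \<in> ?F" "b \<in> U b'" ..
    have "\<eta> b b' \<in> underS lam \<mu>" by (rule Y) (use b b' in auto)
    then have "(b, b') \<in> closure_step e a \<mu>" using \<eta>(2)[OF b'(2)] by (force simp: closure_step_def)
    then have "r \<mu> b \<noteq> r \<mu> b'" by (intro colorsD[OF r \<mu>(1) b'(2)] r_into_rtrancl)
    then show False using b b' by simp
  qed
  then show ?thesis using GB sup smallG \<mu>(1) by blast
qed

section \<open>The two conclusions at a given guessing point\<close>

text \<open>What remains is to see that the approachability witness \<open>A\<close> has small
  initial segments: its order type is an initial ordinal of size at most \<open>th\<close>, so each
  proper initial segment has fewer than \<open>th\<close> elements.\<close>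

lemma Iideal_subset_Jideal:
  assumes S: "S \<subseteq> Ecof k th" "S \<in> Iideal k"
  shows "S \<in> Jideal k"
proof -
  obtain a C where C: "club k C"
    and app: "\<forall>\<alpha>\<in>S \<inter> C. \<exists>A. cofinal_sub k A \<alpha> \<and> Card_order (Restr k A) \<and>
      (\<forall>B. cofinal_sub k B \<alpha> \<longrightarrow> |A| \<le>o |B| ) \<and>
      (\<forall>\<gamma>\<in>U \<alpha>. \<exists>\<beta>\<in>U \<alpha>. A \<inter> U \<gamma> = a \<beta>)"
    using S(2) unfolding Iideal_def by blast
  obtain r where r: "colors e a r" using ex_colors ..
  show ?thesis
  proof (rule Jideal_if_bounded_fibers[OF S(1) C])
    show "r \<mu> b \<in> Field lam" if "\<mu> \<in> Field lam" for \<mu> b using r that by (simp add: colors_def)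
    fix \<alpha> B assume a: "\<alpha> \<in> S \<inter> C" and B: "sup_is k B \<alpha>"
    then have \<alpha>: "\<alpha> \<in> Ecof k th" using S(1) by blast
    from bspec[OF app a] obtain A where A: "cofinal_sub k A \<alpha>" "Card_order (Restr k A)"
      "\<forall>B. cofinal_sub k B \<alpha> \<longrightarrow> |A| \<le>o |B|" "\<forall>\<gamma>\<in>U \<alpha>. \<exists>\<beta>\<in>U \<alpha>. A \<inter> U \<gamma> = a \<beta>"
      by (elim exE conjE)
    have sup: "sup_is k A \<alpha>" using A(1) E_cofinal_iff[OF \<alpha>] by simp
    obtain A\<^sub>0 where A0: "sup_is k A\<^sub>0 \<alpha>" "|A\<^sub>0| =o th" using E_ex_cofinal[OF \<alpha>] by blast
    have "|A| \<le>o |A\<^sub>0|" using A(3) A0(1) E_cofinal_iff[OF \<alpha>] by simp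
    then have "|A| \<le>o th" by (rule ordLeq_ordIso_trans[OF _ A0(2)])
    have AF: "A \<subseteq> Field k" using sup underS_FieldD(1)[of _ k \<alpha>] by (auto simp: sup_is_iff)
    then have F: "Field (Restr k A) = A"
      using Well_order_k Refl_Field_Restr2 by (auto simp: order_on_defs)
    have "Restr k A =o |A|" using card_of_Field_ordIso[OF A(2)] F ordIso_symmetric by metis
    then have R: "Restr k A \<le>o th" by (rule ordIso_ordLeq_trans[OF _ \<open>|A| \<le>o th\<close>])
    have "|A \<inter> U \<gamma>| <o th" if "\<gamma> \<in> U \<alpha>" for \<gamma>
    proof -
      have "\<exists>\<delta>\<in>A. \<gamma> \<in> U \<delta>" using sup that by (simp add: sup_is_iff)
      then obtain \<delta> where d: "\<delta> \<in> A" "\<gamma> \<in> U \<delta>" ..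
      have "A \<inter> U \<gamma> \<subseteq> underS (Restr k A) \<delta>"
        using U_subset[OF d(2)] d(1) by (auto simp: underS_def)
      moreover have "|underS (Restr k A) \<delta>| <o th"
        using ordLess_ordLeq_trans[OF card_of_underS[OF A(2)] R] d(1) F by metis
      ultimately show ?thesis by (rule card_subset_less)
    qed
    then show "\<exists>G\<subseteq>B. sup_is k G \<alpha> \<and> (\<forall>\<gamma>\<in>U \<alpha>. |G \<inter> U \<gamma>| <o th) \<and>
        (\<exists>\<mu>\<in>Field lam. \<forall>v. \<not> sup_is k {g\<in>G. r \<mu> g = v} \<alpha>)"
      by (rule bounded_fibers_if_approachable[OF r \<alpha> sup _ bspec[OF A(4)] B])
  qed
qed

lemma Ecof_in_Jideal_if_regular:
  assumes "regularCard lam"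
  shows "Ecof k th \<in> Jideal k"
proof -
  obtain r where r: "colors e (\<lambda>_. {}) r" using ex_colors ..
  show ?thesis
  proof (rule Jideal_if_bounded_fibers[OF subset_refl club_Field])
    show "r \<mu> b \<in> Field lam" if "\<mu> \<in> Field lam" for \<mu> b using r that by (simp add: colors_def)
    fix \<alpha> B assume "\<alpha> \<in> Ecof k th \<inter> Field k" "sup_is k B \<alpha>"
    then show "\<exists>G\<subseteq>B. sup_is k G \<alpha> \<and> (\<forall>\<gamma>\<in>U \<alpha>. |G \<inter> U \<gamma>| <o th) \<and>
        (\<exists>\<mu>\<in>Field lam. \<forall>v. \<not> sup_is k {g\<in>G. r \<mu> g = v} \<alpha>)"
      by (intro bounded_fibers_if_regular[OF assms r]) auto
  qed
qed

end

section \<open>From a stationary set to a guessing point, and the theorem\<close>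

text \<open>Stationarity enters only here: \<open>T\<close> meets the part above \<open>j\<close> of
  the witnessing club, and any point of that intersection can serve as
  \<open>\<alpha>\<^sub>0\<close>.\<close>

lemma (in succ_card) ex_J_point:
  assumes T: "stationary k T" "T \<subseteq> Ecof k th" "T \<in> Jideal k"
  shows "\<exists>j e \<alpha>\<^sub>0 F. J_point lam th k j e \<alpha>\<^sub>0 F"
proof -
  obtain j where j: "j \<in> Field k" "|U j| =o lam" using ex_card_U_eq ..
  obtain e where e: "\<forall>\<beta>. (U \<beta> \<noteq> {} \<longrightarrow> e \<beta> ` Field lam = U \<beta>) \<and> (j \<in> U \<beta> \<longrightarrow> inj_on (e \<beta>) (Field lam))"
    using ex_enumeration[OF j] ..
  obtain C F where C: "club k C"
    and sub: "\<forall>i\<in>Field k. \<forall>\<beta>\<in>Field k. F i \<beta> = {} \<or> (\<exists>x\<in>Field k. F i \<beta> = {x})"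
    and F: "\<forall>\<alpha>\<in>T \<inter> C. \<forall>f B. regressive k f \<alpha> \<and> cofinal_sub k B \<alpha> \<longrightarrow>
      (\<exists>i\<in>U \<alpha>. sup_is k {\<beta>\<in>B. f \<beta> \<in> F i \<beta>} \<alpha>)"
    using T(3) unfolding Jideal_def by blast
  have "T \<inter> {\<beta>\<in>C. j \<in> U \<beta>} \<noteq> {}" using T(1) club_tail[OF C j(1)] unfolding stationary_def by blast
  then obtain \<alpha>\<^sub>0 where \<alpha>\<^sub>0: "\<alpha>\<^sub>0 \<in> T \<inter> C" "j \<in> U \<alpha>\<^sub>0" by blast
  then have E: "\<alpha>\<^sub>0 \<in> Ecof k th" using T(2) by blast
  have "J_point lam th k j e \<alpha>\<^sub>0 F"
  proof unfold_locales
    show "e \<beta> ` Field lam = U \<beta>" if "U \<beta> \<noteq> {}" for \<beta> using e that by blast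
    show "inj_on (e \<beta>) (Field lam)" if "j \<in> U \<beta>" for \<beta> using e that by blast
    show "x = y" if "i \<in> Field k" "\<beta> \<in> Field k" "x \<in> F i \<beta>" "y \<in> F i \<beta>" for i \<beta> x y
      using bspec[OF bspec[OF sub that(1)] that(2)] that(3,4) by auto
    show "\<exists>i\<in>U \<alpha>\<^sub>0. sup_is k {\<beta>\<in>B. f \<beta> \<in> F i \<beta>} \<alpha>\<^sub>0"
      if "regressive k f \<alpha>\<^sub>0" "sup_is k B \<alpha>\<^sub>0" for f B
      using bspec[OF F \<alpha>\<^sub>0(1)] that E_cofinal_iff[OF E] by blast
  qed (use j E \<alpha>\<^sub>0 in auto)
  then show ?thesis by blast
qed

theorem theoremC:
  fixes lam :: "'b rel" and th :: "'c rel"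
  assumes "Card_order lam" and "infinite (Field lam)"
    and "Card_order th" and "infinite (Field th)"
    and "th <o lam"
  shows "((\<exists>S. stationary (cardSuc lam) S \<and> S \<subseteq> Ecof (cardSuc lam) th \<and> S \<in> Jideal (cardSuc lam)) \<longrightarrow>
           (\<forall>S. stationary (cardSuc lam) S \<and> S \<subseteq> Ecof (cardSuc lam) th \<and> S \<in> Iideal (cardSuc lam)
                \<longrightarrow> S \<in> Jideal (cardSuc lam)))
       \<and> (regularCard lam \<and>
           (\<exists>S. stationary (cardSuc lam) S \<and> S \<subseteq> Ecof (cardSuc lam) th \<and> S \<in> Jideal (cardSuc lam)) \<longrightarrow>
           Ecof (cardSuc lam) th \<in> Jideal (cardSuc lam))"
proof -
  interpret succ_card lam th "cardSuc lam"
  proof unfold_locales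
    fix x assume "x \<in> Field (cardSuc lam)"
    then have "|underS (cardSuc lam) x| <o cardSuc lam"
      by (rule card_of_underS[OF cardSuc_Card_order[OF assms(1)]])
    then show "|underS (cardSuc lam) x| \<le>o lam"
      using cardSuc_ordLeq_ordLess[OF assms(1) card_of_Card_order] by blast
  qed (use assms cardSuc_Card_order cardSuc_greater in auto)
  show ?thesis
  proof (intro conjI impI allI; elim conjE exE)
    fix S T
    assume "stationary (cardSuc lam) T" "T \<subseteq> Ecof (cardSuc lam) th" "T \<in> Jideal (cardSuc lam)"
    then obtain j e \<alpha>\<^sub>0 F where "J_point lam th (cardSuc lam) j e \<alpha>\<^sub>0 F" using ex_J_point by blast
    moreover assume "S \<subseteq> Ecof (cardSuc lam) th" "S \<in> Iideal (cardSuc lam)"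
    ultimately show "S \<in> Jideal (cardSuc lam)" by (rule J_point.Iideal_subset_Jideal)
  next
    fix T
    assume "stationary (cardSuc lam) T" "T \<subseteq> Ecof (cardSuc lam) th" "T \<in> Jideal (cardSuc lam)"
    then obtain j e \<alpha>\<^sub>0 F where "J_point lam th (cardSuc lam) j e \<alpha>\<^sub>0 F" using ex_J_point by blast
    moreover assume "regularCard lam"
    ultimately show "Ecof (cardSuc lam) th \<in> Jideal (cardSuc lam)"
      by (rule J_point.Ecof_in_Jideal_if_regular)
  qed
qed

end
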